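(* Let $p$ be an odd prime number. For any Dehn $p$-colorable knot $K$, $$\mathrm{mincol}^{\mathrm{Dehn}}_p(K)\ \geq\ \log_2 p+1,$$ that is, $$\mathrm{mincol}^{\mathrm{Dehn}}_p(K)\ \geq\ \lfloor \log_2 p\rfloor+2 .$$
   Context: $\mathbb Z_p=\mathbb Z/p\mathbb Z$. Let $D$ be a diagram of a knot $K$, and let $\mathcal R(D)$ be the set of regions of $D$ (connected components of the complement of the underlying immersed curve). At each crossing the four surrounding regions are named $x_1,x_2,x_3,x_4$ (not necessarily distinct) so that $x_2$ is adjacent to $x_1$ across an under-arc, $x_3$ is adjacent to $x_1$ across the over-arc, and $x_4$ is opposite to $x_1$. A Dehn $p$-coloring of $D$ is a map $C:\mathcal R(D)\to\mathbb Z_p$ such that $C(x_1)+C(x_3)=C(x_2)+C(x_4)$ at each crossing. A crossing is trivially colored by $C$ if $C(x_1)=C(x_4)$ and $C(x_3)=C(x_2)$ there. $C$ is trivial if every crossing is trivially colored, and nontrivial otherwise. A pair $(D,C)$ is called a Dehn $p$-colored diagram; it is a nontrivially Dehn $p$-colored diagram if $C$ is nontrivial. $\mathcal C(D,C)=\mathrm{Im}\,C\subset\mathbb Z_p$ is the set of colors used. A knot $K$ is Dehn $p$-colorable if some diagram $D$ of $K$ has a nontrivial Dehn $p$-coloring. For a Dehn $p$-colorable knot $K$, $\mathrm{mincol}^{\mathrm{Dehn}}_p(K)$ is the minimum of $\#\mathcal C(D,C)$ over all nontrivially Dehn $p$-colored diagrams $(D,C)$ of $K$. *)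

theory Defs
  imports "HOL-Analysis.Analysis" "HOL-Number_Theory.Residues"
begin

text \<open>
  We work in the smooth category. A closed curve is a map on the reals of period 1, and the
  parameter interval \<open>[0,1)\<close> runs through it once.
\<close>

definition smooth :: "(real \<Rightarrow> 'a::real_normed_vector) \<Rightarrow> bool" where
  "smooth f \<longleftrightarrow>
     (\<exists>d. d 0 = f \<and> (\<forall>(n::nat) t. (d n has_vector_derivative d (Suc n) t) (at t)))"

definition smooth_loop :: "(real \<Rightarrow> 'a::real_normed_vector) \<Rightarrow> bool" where
  "smooth_loop f \<longleftrightarrow> smooth f \<and> (\<forall>t. f (t + 1) = f t)"

definition immersed_loop :: "(real \<Rightarrow> 'a::real_normed_vector) \<Rightarrow> bool" where
  "immersed_loop f \<longleftrightarrow> smooth_loop f \<and> (\<forall>t. vector_derivative f (at t) \<noteq> 0)"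

definition knot :: "(real ^ 3) set \<Rightarrow> bool" where
  "knot K \<longleftrightarrow> (\<exists>g. immersed_loop g \<and> inj_on g {0..<1} \<and> K = range g)"

definition ambient_isotopic :: "(real ^ 3) set \<Rightarrow> (real ^ 3) set \<Rightarrow> bool" where
  "ambient_isotopic K L \<longleftrightarrow>
     (\<exists>H :: real \<Rightarrow> real ^ 3 \<Rightarrow> real ^ 3.
        continuous_on ({0..1} \<times> UNIV) (\<lambda>(t, x). H t x) \<and>
        (\<forall>t\<in>{0..1}. \<exists>G. homeomorphism UNIV UNIV (H t) G) \<and>
        (\<forall>x. H 0 x = x) \<and> H 1 ` K = L)"

text \<open>
  A diagram consists of its underlying plane curve and, for each crossing, the ordered pair
  \<open>(s, t)\<close> of parameters in \<open>[0,1)\<close> mapped to it, the strand at \<open>s\<close> being the upper one.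
\<close>

record diagram =
  curve :: "real \<Rightarrow> real ^ 2"
  crossings :: "(real \<times> real) set"

text \<open>
  Transversality is \<^term>\<open>\<not> collinear {0, u, v}\<close> for the two velocities, rather than independence of
  the set \<^term>\<open>{u, v}\<close>, which would not exclude equal velocities.
\<close>

definition knot_diagram :: "diagram \<Rightarrow> bool" where
  "knot_diagram D \<longleftrightarrow>
     immersed_loop (curve D) \<and>
     finite (crossings D) \<and> crossings D \<subseteq> {0..<1} \<times> {0..<1} \<and>
     (\<forall>s\<in>{0..<1}. \<forall>t\<in>{0..<1}. s \<noteq> t \<and> curve D s = curve D t \<longleftrightarrow>
        (s, t) \<in> crossings D \<or> (t, s) \<in> crossings D) \<and>
     (\<forall>(s, t)\<in>crossings D. (t, s) \<notin> crossings D \<and>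
        \<not> collinear {0, vector_derivative (curve D) (at s), vector_derivative (curve D) (at t)}) \<and>
     (\<forall>r\<in>{0..<1}. \<forall>s\<in>{0..<1}. \<forall>t\<in>{0..<1}.
        curve D r = curve D s \<and> curve D s = curve D t \<longrightarrow> r = s \<or> s = t \<or> r = t)"

text \<open>
  A diagram represents \<open>K\<close> if lifting its curve by some height function compatible with the crossing
  information gives a knot ambient isotopic to \<open>K\<close>.
\<close>

definition lift_curve :: "(real \<Rightarrow> real ^ 2) \<Rightarrow> (real \<Rightarrow> real) \<Rightarrow> real \<Rightarrow> real ^ 3" where
  "lift_curve c h t = vector [c t $ 1, c t $ 2, h t]"

definition diagram_of :: "diagram \<Rightarrow> (real ^ 3) set \<Rightarrow> bool" where
  "diagram_of D K \<longleftrightarrow>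
     knot_diagram D \<and>
     (\<exists>h. smooth_loop h \<and> (\<forall>(s, t)\<in>crossings D. h t < h s) \<and>
          ambient_isotopic (range (lift_curve (curve D) h)) K)"

definition regions :: "diagram \<Rightarrow> (real ^ 2) set set" where
  "regions D = components (- range (curve D))"

text \<open>
  Let \<open>u\<close> and \<open>v\<close> be the velocities of the upper and the lower strand at a crossing \<open>P\<close>. The points
  \<open>P + e (a u + b v)\<close> with \<open>a, b\<close> fixed nonzero reals and small \<open>e > 0\<close> avoid the curve and thus stay
  in a single region, which depends only on the signs of \<open>a\<close> and \<open>b\<close>. Since the under-arcs at \<open>P\<close>
  have directions \<open>v\<close> and \<open>-v\<close>, passing across an under-arc changes the sign of \<open>a\<close>; passing across
  the over-arc changes the sign of \<open>b\<close>.
\<close>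

definition corner_region :: "diagram \<Rightarrow> real \<times> real \<Rightarrow> real \<Rightarrow> real \<Rightarrow> (real ^ 2) set" where
  "corner_region D x a b =
     (let P = curve D (fst x);
          u = vector_derivative (curve D) (at (fst x));
          v = vector_derivative (curve D) (at (snd x))
      in THE R. R \<in> regions D \<and>
           (\<forall>\<^sub>F e in at_right 0. P + e *\<^sub>R (a *\<^sub>R u + b *\<^sub>R v) \<in> R))"

text \<open>
  The choice of \<open>x\<^sub>1\<close> among the four corners is immaterial: the equation defining Dehn colorings
  and the condition of being trivially colored are the same for all four choices.
\<close>

definition region_x1 :: "diagram \<Rightarrow> real \<times> real \<Rightarrow> (real ^ 2) set" where
  "region_x1 D x = corner_region D x 1 1"

definition region_x2 :: "diagram \<Rightarrow> real \<times> real \<Rightarrow> (real ^ 2) set" where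
  "region_x2 D x = corner_region D x (- 1) 1"

definition region_x3 :: "diagram \<Rightarrow> real \<times> real \<Rightarrow> (real ^ 2) set" where
  "region_x3 D x = corner_region D x 1 (- 1)"

definition region_x4 :: "diagram \<Rightarrow> real \<times> real \<Rightarrow> (real ^ 2) set" where
  "region_x4 D x = corner_region D x (- 1) (- 1)"

definition dehn_coloring :: "nat \<Rightarrow> diagram \<Rightarrow> ((real ^ 2) set \<Rightarrow> int) \<Rightarrow> bool" where
  "dehn_coloring p D C \<longleftrightarrow>
     C \<in> regions D \<rightarrow> carrier (residue_ring (int p)) \<and>
     (\<forall>x\<in>crossings D. C (region_x1 D x) \<oplus>\<^bsub>residue_ring (int p)\<^esub> C (region_x3 D x)
                     = C (region_x2 D x) \<oplus>\<^bsub>residue_ring (int p)\<^esub> C (region_x4 D x))"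

definition trivially_colored_at ::
    "diagram \<Rightarrow> ((real ^ 2) set \<Rightarrow> int) \<Rightarrow> real \<times> real \<Rightarrow> bool" where
  "trivially_colored_at D C x \<longleftrightarrow> C (region_x1 D x) = C (region_x4 D x) \<and> C (region_x3 D x) = C (region_x2 D x)"

definition trivial_coloring :: "diagram \<Rightarrow> ((real ^ 2) set \<Rightarrow> int) \<Rightarrow> bool" where
  "trivial_coloring D C \<longleftrightarrow> (\<forall>x\<in>crossings D. trivially_colored_at D C x)"

definition colors_used :: "diagram \<Rightarrow> ((real ^ 2) set \<Rightarrow> int) \<Rightarrow> int set" where
  "colors_used D C = C ` regions D"

definition nontrivially_colored_diagram_of ::
    "nat \<Rightarrow> (real ^ 3) set \<Rightarrow> diagram \<Rightarrow> ((real ^ 2) set \<Rightarrow> int) \<Rightarrow> bool" where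
  "nontrivially_colored_diagram_of p K D C \<longleftrightarrow>
     diagram_of D K \<and> dehn_coloring p D C \<and> \<not> trivial_coloring D C"

definition dehn_colorable :: "nat \<Rightarrow> (real ^ 3) set \<Rightarrow> bool" where
  "dehn_colorable p K \<longleftrightarrow> (\<exists>D C. nontrivially_colored_diagram_of p K D C)"

definition mincol_dehn :: "nat \<Rightarrow> (real ^ 3) set \<Rightarrow> nat" where
  "mincol_dehn p K =
     (LEAST n. \<exists>D C. nontrivially_colored_diagram_of p K D C \<and> n = card (colors_used D C))"

end

theory Submission
  imports Defs "Jordan_Normal_Form.Determinant"
begin

text \<open>
  Let \<open>n\<close> be the number of colors of a nontrivial Dehn \<open>p\<close>-coloring. The crossings impose on the colors
  homogeneous linear equations over the integers, and after normalizing one color to 0 every minor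
  of this system is at most \<open>2 ^ (n - 1)\<close> in absolute value, since every row is the sum of two rows of
  the incidence matrix of a directed graph. If \<open>p > 2 ^ (n - 1)\<close>, no nonzero minor vanishes modulo \<open>p\<close>,
  so a multiple of the coloring prime to \<open>p\<close> lifts to an integral Dehn coloring. But integral Dehn
  colorings of a knot diagram are trivial: adding the colors on the two sides of an arc gives an
  integral Fox coloring, whose values are congruent modulo every power of 2 by induction on the
  exponent, and hence all equal.
\<close>

section \<open>Minors of crossing equations\<close>

text \<open>The unknowns of the linear system are the colors, not the regions: a solution is a map
  \<open>h\<close> on colors, and \<open>h\<close> composed with the coloring is an integral Dehn
  coloring. Constants always satisfy the crossing equations, so one color can be normalized away;
  hence the exponent n - 1 rather than n. Being congruent modulo p to an invertible multiple of the
  normalized identity map, \<open>h\<close> is injective on colors, so triviality of the integral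
  coloring passes back to the given one.

  Powers of 2 enter through the Fox relation: the difference of the two under-arcs is twice the
  difference of over-arc and under-arc. Passing from local to global agreement uses that a knot is a
  single closed curve, so that all arcs lie on one connected parameter line.

  The main obstacle is geometric. Regions are components of the complement of a smooth curve, so the
  two sides of an arc and the four corners of a crossing have to be found analytically. No arcs or
  planar graph are constructed: colors are read off at parameters, by leaving the curve in a
  transverse direction.\<close>

text \<open>Total unimodularity of incidence matrices of directed graphs: row \<open>i\<close> is an
  edge from \<open>b i\<close> to \<open>a i\<close>, and \<open>g\<close> selects vertices. If both
  ends of every edge are selected, each row has sum zero and the matrix is singular; otherwise some
  row has at most one nonzero entry, and expansion along it reduces the size.\<close>

lemma abs_det_incidence_le_1:
  fixes g :: "nat \<Rightarrow> 'c"
  assumes "inj_on g {..<r}"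
  shows "\<bar>det (mat r r (\<lambda>(i, j). of_bool (g j = a i) - of_bool (g j = b i) :: int))\<bar> \<le> 1"
  using assms
proof (induction r arbitrary: g a b)
  case 0
  then show ?case by simp
next
  case (Suc r)
  let ?A = "mat (Suc r) (Suc r) (\<lambda>(i, j). of_bool (g j = a i) - of_bool (g j = b i) :: int)"
  have A: "?A \<in> carrier_mat (Suc r) (Suc r)" by simp
  have minor: "\<bar>det (mat_delete ?A i k)\<bar> \<le> 1" if "i < Suc r" "k < Suc r" for i k
  proof -
    have "mat_delete ?A i k = mat r r (\<lambda>(i', j'). of_bool ((g \<circ> insert_index k) j' = (a \<circ> insert_index i) i')
        - of_bool ((g \<circ> insert_index k) j' = (b \<circ> insert_index i) i'))"
      unfolding mat_delete_def by (rule eq_matI) (auto simp: insert_index_def)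
    moreover have "inj_on (g \<circ> insert_index k) {..<r}"
    proof (rule comp_inj_on)
      show "inj_on g (insert_index k ` {..<r})"
        by (rule inj_on_subset[OF Suc.prems]) (auto simp: insert_index_def)
    qed (rule insert_index_inj_on)
    ultimately show ?thesis using Suc.IH by presburger
  qed
  show ?case
  proof (cases "\<forall>i<Suc r. a i \<in> g ` {..<Suc r} \<and> b i \<in> g ` {..<Suc r}")
    case True
    have one: "(\<Sum>j<Suc r. of_bool (g j = z)) = (1::int)" if z: "z \<in> g ` {..<Suc r}" for z
    proof -
      obtain k where k: "k < Suc r" "z = g k" using z by blast
      have "(\<Sum>j<Suc r. of_bool (g j = z)) = (\<Sum>j<Suc r. of_bool (j = k) :: int)"
        by (rule sum.cong) (use k Suc.prems in \<open>auto simp: inj_on_def\<close>)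
      also have "\<dots> = 1" using k(1) by (simp add: of_bool_def del: sum.lessThan_Suc)
      finally show ?thesis .
    qed
    have "?A *\<^sub>v vec (Suc r) (\<lambda>_. 1) = 0\<^sub>v (Suc r)"
    proof (rule eq_vecI)
      fix i assume "i < dim_vec (0\<^sub>v (Suc r) :: int vec)"
      then have i: "i < Suc r" by simp
      have "vec_index (?A *\<^sub>v vec (Suc r) (\<lambda>_. 1)) i = (\<Sum>j<Suc r. of_bool (g j = a i) - of_bool (g j = b i))"
        using i by (simp add: scalar_prod_def atLeast0LessThan del: sum.lessThan_Suc)
      also have "\<dots> = 0" using True i one by (simp add: sum_subtractf del: sum.lessThan_Suc)
      finally show "vec_index (?A *\<^sub>v vec (Suc r) (\<lambda>_. 1)) i = vec_index (0\<^sub>v (Suc r)) i" using i by simp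
    qed simp
    moreover have "vec (Suc r) (\<lambda>_. 1) \<noteq> (0\<^sub>v (Suc r) :: int vec)"
    proof
      assume "vec (Suc r) (\<lambda>_. 1) = (0\<^sub>v (Suc r) :: int vec)"
      then have "vec_index (vec (Suc r) (\<lambda>_. 1)) 0 = vec_index (0\<^sub>v (Suc r) :: int vec) 0" by simp
      then show False by simp
    qed
    ultimately have "det ?A = 0"
      using det_0_iff_vec_prod_zero[OF A] vec_carrier[of "Suc r" "\<lambda>_. 1 :: int"] by blast
    then show ?thesis by simp
  next
    case False
    then obtain i where i: "i < Suc r" "\<not> (a i \<in> g ` {..<Suc r} \<and> b i \<in> g ` {..<Suc r})" by blast
    have "\<exists>k<Suc r. \<forall>j<Suc r. j \<noteq> k \<longrightarrow> ?A $$ (i, j) = 0"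
    proof -
      obtain k where k: "k < Suc r" "\<forall>j<Suc r. j \<noteq> k \<longrightarrow> g j \<noteq> a i \<and> g j \<noteq> b i"
      proof (cases "a i \<in> g ` {..<Suc r}")
        case True
        then obtain k where "k < Suc r" "a i = g k" by auto
        then show ?thesis using that[of k] i(2) inj_onD[OF Suc.prems] by (metis imageI lessThan_iff)
      next
        case nota: False
        show ?thesis
        proof (cases "b i \<in> g ` {..<Suc r}")
          case True
          then obtain k where "k < Suc r" "b i = g k" by auto
          then show ?thesis using that[of k] nota inj_onD[OF Suc.prems] by (metis imageI lessThan_iff)
        next
          case False
          then show ?thesis using that[of 0] nota by (metis imageI lessThan_iff zero_less_Suc)
        qed
      qed
      then show ?thesis using i(1) by (intro exI[of _ k]) auto
    qed
    then obtain k where k: "k < Suc r" and z: "\<And>j. j < Suc r \<Longrightarrow> j \<noteq> k \<Longrightarrow> ?A $$ (i, j) = 0" by blast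
    have "det ?A = (\<Sum>j<Suc r. ?A $$ (i, j) * cofactor ?A i j)"
      by (rule laplace_expansion_row[OF A i(1)])
    also have "\<dots> = (\<Sum>j\<in>{k}. ?A $$ (i, j) * cofactor ?A i j)"
      by (rule sum.mono_neutral_right) (use k z in auto)
    finally have "\<bar>det ?A\<bar> = \<bar>?A $$ (i, k)\<bar> * \<bar>det (mat_delete ?A i k)\<bar>"
      by (simp add: cofactor_def abs_mult power_abs)
    also have "\<dots> \<le> 1 * 1"
      by (rule mult_mono) (use i k minor in auto)
    finally show ?thesis by simp
  qed
qed

text \<open>The three matrices have the same minors along row \<open>k\<close>, so Laplace expansion
  there is additive. The factor \<open>of_bool (i = k)\<close> fits the way in which second
  incidence summands are switched on row by row below.\<close>

lemma det_add_row:
  fixes f h :: "nat \<Rightarrow> nat \<Rightarrow> 'a :: comm_ring_1"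
  assumes "k < r"
  shows "det (mat r r (\<lambda>(i, j). f i j + of_bool (i = k) * h i j))
       = det (mat r r (\<lambda>(i, j). f i j)) + det (mat r r (\<lambda>(i, j). if i = k then h i j else f i j))"
proof -
  define A where "A = mat r r (\<lambda>(i, j). f i j + of_bool (i = k) * h i j)"
  define B where "B = mat r r (\<lambda>(i, j). f i j)"
  define C where "C = mat r r (\<lambda>(i, j). if i = k then h i j else f i j)"
  note defs = A_def B_def C_def
  have car: "A \<in> carrier_mat r r" "B \<in> carrier_mat r r" "C \<in> carrier_mat r r"
    by (simp_all add: defs)
  have "mat_delete A k j = mat_delete B k j" "mat_delete A k j = mat_delete C k j" for j
    unfolding mat_delete_def by (rule eq_matI; use assms in \<open>force simp: defs\<close>)+
  then have "A $$ (k, j) * cofactor A k j = B $$ (k, j) * cofactor B k j + C $$ (k, j) * cofactor C k j"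
    if "j < r" for j
    using that assms by (simp add: cofactor_def defs algebra_simps)
  then have "det A = det B + det C"
    by (simp add: laplace_expansion_row[OF car(1) assms] laplace_expansion_row[OF car(2) assms]
        laplace_expansion_row[OF car(3) assms] flip: sum.distrib)
  then show ?thesis by (simp only: defs)
qed

text \<open>
  A crossing equation is a sum of two rows of incidence type, and the determinant is additive in
  each row; hence the factor 2 for each such row.
\<close>

lemma abs_det_double_incidence_le:
  fixes g :: "nat \<Rightarrow> 'c"
  assumes "finite S" "S \<subseteq> {..<r}" "inj_on g {..<r}"
  shows "\<bar>det (mat r r (\<lambda>(i, j). of_bool (g j = a i) - of_bool (g j = b i)
            + of_bool (i \<in> S) * (of_bool (g j = c i) - of_bool (g j = d i)) :: int))\<bar> \<le> 2 ^ card S"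
  using assms(1,2)
proof (induction S arbitrary: a b rule: finite_induct)
  case empty
  then show ?case using abs_det_incidence_le_1[OF assms(3)] by simp
next
  case (insert s S)
  define F :: "(nat \<Rightarrow> 'c) \<Rightarrow> (nat \<Rightarrow> 'c) \<Rightarrow> nat \<Rightarrow> nat \<Rightarrow> int" where
    "F a b i j = of_bool (g j = a i) - of_bool (g j = b i)
            + of_bool (i \<in> S) * (of_bool (g j = c i) - of_bool (g j = d i))" for a b i j
  define h :: "nat \<Rightarrow> nat \<Rightarrow> int" where "h i j = of_bool (g j = c i) - of_bool (g j = d i)" for i j
  have s: "s < r" using insert.prems by auto
  have IH: "\<bar>det (mat r r (\<lambda>(i, j). F a b i j))\<bar> \<le> 2 ^ card S" for a b
    unfolding F_def using insert.IH[of a b] insert.prems by simp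
  have "mat r r (\<lambda>(i, j). of_bool (g j = a i) - of_bool (g j = b i)
            + of_bool (i \<in> insert s S) * (of_bool (g j = c i) - of_bool (g j = d i)) :: int)
      = mat r r (\<lambda>(i, j). F a b i j + of_bool (i = s) * h i j)"
    by (rule eq_matI) (use insert.hyps in \<open>auto simp: F_def h_def\<close>)
  \<comment> \<open>Keeping only the second summand in row \<open>s\<close> again gives a single
    incidence row, with ends \<open>c s\<close> and \<open>d s\<close>. The family is thus closed
    under splitting, provided the induction leaves \<open>a\<close> and \<open>b\<close>
    free.\<close>
  moreover have "mat r r (\<lambda>(i, j). if i = s then h i j else F a b i j)
      = mat r r (\<lambda>(i, j). F (a(s := c s)) (b(s := d s)) i j)"
    by (rule eq_matI) (use insert.hyps in \<open>auto simp: F_def h_def\<close>)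
  ultimately have "det (mat r r (\<lambda>(i, j). of_bool (g j = a i) - of_bool (g j = b i)
            + of_bool (i \<in> insert s S) * (of_bool (g j = c i) - of_bool (g j = d i)) :: int))
      = det (mat r r (\<lambda>(i, j). F a b i j)) + det (mat r r (\<lambda>(i, j). F (a(s := c s)) (b(s := d s)) i j))"
    using det_add_row[OF s, of "F a b" h] by simp
  also have "\<bar>\<dots>\<bar> \<le> 2 ^ card S + 2 ^ card S"
    using IH[of a b] IH[of "a(s := c s)" "b(s := d s)"] by linarith
  finally show ?case using insert.hyps by simp
qed

text \<open>
  Take a nonzero minor \<open>\<Delta>\<close> of maximal size. By maximality all rows depend on the rows of the minor,
  and subtracting from \<open>\<Delta> x\<close> the adjugate applied to the residues \<open>\<rho> i \<cdot> x\<close> (multiples of \<open>p\<close>)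
  gives an integral solution. It is still nonzero modulo \<open>p\<close> where \<open>x\<close> is, since \<open>0 < \<bar>\<Delta>\<bar> < p\<close>.
\<close>

lemma lift_solution_mod_prime:
  fixes E :: "('c \<Rightarrow> int) set" and x :: "'c \<Rightarrow> int" and p :: int
  assumes W: "finite W"
    and minors: "\<And>r \<rho> g. \<rho> ` {..<r} \<subseteq> E \<Longrightarrow> inj_on g {..<r} \<Longrightarrow> g ` {..<r} \<subseteq> W \<Longrightarrow>
        \<bar>det (mat r r (\<lambda>(i, j). \<rho> i (g j)))\<bar> < p"
    and sol: "\<And>e. e \<in> E \<Longrightarrow> p dvd (\<Sum>j\<in>W. e j * x j)"
  obtains y d where "\<not> p dvd d" "\<And>j. p dvd y j - d * x j" "\<And>e. e \<in> E \<Longrightarrow> (\<Sum>j\<in>W. e j * y j) = 0"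
proof -
  define P where "P r \<longleftrightarrow> (\<exists>\<rho> g. \<rho> ` {..<r} \<subseteq> E \<and> inj_on g {..<r} \<and> g ` {..<r} \<subseteq> W \<and>
        det (mat r r (\<lambda>(i, j). \<rho> i (g j))) \<noteq> 0)" for r
  \<comment> \<open>The empty minor has determinant 1, so a maximal \<open>r\<close> exists even if
    all equations vanish.\<close>
  have P0: "P 0" unfolding P_def by simp
  have bound: "r \<le> card W" if "P r" for r
    using that W unfolding P_def by (metis card_image card_lessThan card_mono)
  define r where "r = (GREATEST r. P r)"
  have "P r" unfolding r_def by (rule GreatestI_nat[of P, OF P0]) (use bound in blast)
  then obtain \<rho> g where \<rho>: "\<rho> ` {..<r} \<subseteq> E" and g: "inj_on g {..<r}" "g ` {..<r} \<subseteq> W"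
    and nz: "det (mat r r (\<lambda>(i, j). \<rho> i (g j))) \<noteq> 0"
    unfolding P_def by blast
  have nP: "\<not> P (Suc r)"
  proof
    assume "P (Suc r)"
    then have "Suc r \<le> r" unfolding r_def by (rule Greatest_le_nat) (use bound in blast)
    then show False by simp
  qed
  define B where "B = mat r r (\<lambda>(i, j). \<rho> i (g j))"
  define \<Delta> where "\<Delta> = det B"
  have B: "B \<in> carrier_mat r r" by (simp add: B_def)
  have \<Delta>: "\<Delta> \<noteq> 0" "\<bar>\<Delta>\<bar> < p" using nz minors[OF \<rho> g] by (simp_all add: \<Delta>_def B_def)
  have "\<not> p dvd \<Delta>" using \<Delta> zdvd_imp_le[of p "\<bar>\<Delta>\<bar>"] by auto
  define res where "res i = (\<Sum>j\<in>W. \<rho> i j * x j)" for i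
  define z where "z k = (\<Sum>l<r. adj_mat B $$ (k, l) * res l)" for k
  \<comment> \<open>The correction is confined to the columns of the minor; by Cramer's rule it
    cancels the error \<open>\<Delta> * res i\<close> in each row \<open>i\<close> of the
    minor.\<close>
  define y where "y j = \<Delta> * x j - (\<Sum>k<r. of_bool (g k = j) * z k)" for j
  have res: "p dvd res i" if "i < r" for i using that \<rho> sol unfolding res_def by blast
  have y_mod: "p dvd y j - \<Delta> * x j" for j
    unfolding y_def z_def by (auto intro!: dvd_sum dvd_mult res)
  have pick: "(\<Sum>j\<in>W. e j * (\<Sum>k<r. of_bool (g k = j) * z k)) = (\<Sum>k<r. e (g k) * z k)" for e :: "'c \<Rightarrow> int"
  proof -
    have "(\<Sum>j\<in>W. e j * (\<Sum>k<r. of_bool (g k = j) * z k)) = (\<Sum>k<r. \<Sum>j\<in>W. of_bool (g k = j) * (e j * z k))"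
      unfolding sum_distrib_left by (subst sum.swap) (simp only: mult_ac)
    also have "\<dots> = (\<Sum>k<r. e (g k) * z k)"
    proof (rule sum.cong[OF refl])
      fix k assume "k \<in> {..<r}"
      then have "g k \<in> W" using g by auto
      have "(\<Sum>j\<in>W. of_bool (g k = j) * (e j * z k)) = (\<Sum>j\<in>W. if g k = j then e j * z k else 0)"
        by (rule sum.cong) auto
      also have "\<dots> = e (g k) * z k" using W \<open>g k \<in> W\<close> by simp
      finally show "(\<Sum>j\<in>W. of_bool (g k = j) * (e j * z k)) = e (g k) * z k" .
    qed
    finally show ?thesis .
  qed
  have row0: "(\<Sum>j\<in>W. \<rho> i j * y j) = 0" if i: "i < r" for i
  proof -
    have BA: "(\<Sum>k<r. B $$ (i, k) * adj_mat B $$ (k, l)) = (if i = l then \<Delta> else 0)" if l: "l < r" for l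
    proof -
      have "(B * adj_mat B) $$ (i, l) = (\<Sum>k<r. B $$ (i, k) * adj_mat B $$ (k, l))"
        using i l B adj_mat(1)[OF B] by (simp add: scalar_prod_def lessThan_atLeast0)
      then show ?thesis using adj_mat(2)[OF B] i l by (auto simp: \<Delta>_def split: if_splits)
    qed
    have "(\<Sum>k<r. \<rho> i (g k) * z k) = (\<Sum>k<r. \<Sum>l<r. B $$ (i, k) * adj_mat B $$ (k, l) * res l)"
      unfolding z_def sum_distrib_left by (intro sum.cong) (use i in \<open>auto simp: B_def\<close>)
    also have "\<dots> = (\<Sum>l<r. (\<Sum>k<r. B $$ (i, k) * adj_mat B $$ (k, l)) * res l)"
      by (subst sum.swap) (simp add: sum_distrib_right)
    also have "\<dots> = (\<Sum>l<r. if i = l then \<Delta> * res l else 0)"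
      by (rule sum.cong) (auto simp: BA)
    also have "\<dots> = \<Delta> * res i" using i by simp
    finally have "(\<Sum>k<r. \<rho> i (g k) * z k) = \<Delta> * res i" .
    then show ?thesis
      unfolding y_def right_diff_distrib sum_subtractf pick
      by (simp add: res_def sum_distrib_left mult.left_commute)
  qed
  have "(\<Sum>j\<in>W. e j * y j) = 0" if e: "e \<in> E" for e
  proof -
    \<comment> \<open>Cofactors, along the last column, of the minor bordered by the row
      \<open>e\<close> and a column \<open>j\<close>. They involve only the first \<open>r\<close>
      columns, so a single relation between the rows holds in all columns \<open>j\<close> at
      once.\<close>
    define K where "K i = (-1) ^ (i + r) * det (mat r r (\<lambda>(i', j'). (\<rho>(r := e)) (insert_index i i') (g j')))" for i
    have K: "(\<Sum>i<Suc r. (\<rho>(r := e)) i j * K i) = 0" if j: "j \<in> W" for j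
    proof -
      define M where "M = mat (Suc r) (Suc r) (\<lambda>(i, j'). (\<rho>(r := e)) i ((g(r := j)) j'))"
      have M: "M \<in> carrier_mat (Suc r) (Suc r)" by (simp add: M_def)
      have "cofactor M i r = K i" if "i < Suc r" for i
      proof -
        have "mat_delete M i r = mat r r (\<lambda>(i', j'). (\<rho>(r := e)) (insert_index i i') (g j'))"
          unfolding mat_delete_def by (rule eq_matI) (use that in \<open>auto simp: M_def insert_index_def\<close>)
        then show ?thesis by (simp add: cofactor_def K_def)
      qed
      then have "det M = (\<Sum>i<Suc r. (\<rho>(r := e)) i j * K i)"
        unfolding laplace_expansion_column[OF M lessI] by (intro sum.cong) (auto simp: M_def)
      \<comment> \<open>A repeated column if \<open>j\<close> already belongs to the minor, and
        otherwise a minor of size \<open>Suc r\<close>, which vanishes by maximality.\<close>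
      moreover have "det M = 0"
      proof (cases "j \<in> g ` {..<r}")
        case True
        then obtain k where k: "k < r" "g k = j" by auto
        show ?thesis
          by (rule det_identical_columns[OF M, of k r]) (use k in \<open>auto simp: M_def intro!: eq_vecI\<close>)
      next
        case False
        have "inj_on (g(r := j)) {..<Suc r}"
          using g False by (auto simp: lessThan_Suc inj_on_def)
        moreover have "(\<rho>(r := e)) ` {..<Suc r} \<subseteq> E" "(g(r := j)) ` {..<Suc r} \<subseteq> W"
          using \<rho> e g j by (auto simp: lessThan_Suc)
        ultimately show ?thesis using nP unfolding P_def M_def by blast
      qed
      ultimately show ?thesis by simp
    qed
    have "K r = \<Delta>"
    proof -
      have "mat r r (\<lambda>(i', j'). (\<rho>(r := e)) (insert_index r i') (g j')) = B"
        unfolding B_def by (rule eq_matI) auto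
      then show ?thesis by (simp add: K_def \<Delta>_def)
    qed
    then have "\<Delta> * e j = - (\<Sum>i<r. \<rho> i j * K i)" if "j \<in> W" for j
      using K[OF that] by (simp add: mult.commute)
    then have "\<Delta> * (\<Sum>j\<in>W. e j * y j) = (\<Sum>j\<in>W. - (\<Sum>i<r. \<rho> i j * K i) * y j)"
      unfolding sum_distrib_left by (intro sum.cong) (auto simp flip: mult.assoc)
    also have "\<dots> = - (\<Sum>j\<in>W. \<Sum>i<r. K i * (\<rho> i j * y j))"
      by (simp add: sum_negf sum_distrib_right) (simp only: mult_ac)
    also have "\<dots> = - (\<Sum>i<r. K i * (\<Sum>j\<in>W. \<rho> i j * y j))"
      unfolding sum_distrib_left by (subst sum.swap) (rule refl)
    also have "\<dots> = 0" using row0 by simp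
    finally show ?thesis using \<Delta> by simp
  qed
  with \<open>\<not> p dvd \<Delta>\<close> y_mod show ?thesis using that by blast
qed

section \<open>Regions near a plane curve\<close>

no_notation scalar_prod (infix "\<bullet>" 70)
no_notation vec_index (infixl "$" 100)

text \<open>Rotation by a quarter turn; \<open>perp u \<bullet> v\<close> is the determinant of
  \<open>u\<close> and \<open>v\<close>. That it is nonzero expresses transversality, and its sign
  tells the side of a line.\<close>

definition perp :: "real ^ 2 \<Rightarrow> real ^ 2" where
  "perp w = vector [- w $ 2, w $ 1]"

lemma perp_add: "perp (x + y) = perp x + perp y"
  and perp_scaleR: "perp (a *\<^sub>R x) = a *\<^sub>R perp x"
  by (simp_all add: perp_def Finite_Cartesian_Product.vec_eq_iff forall_2)

lemma norm_perp: "norm (perp x) = norm x"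
  by (simp add: perp_def norm_eq_sqrt_inner inner_vec_def sum_2 add.commute)

lemma perp_inner_self: "perp x \<bullet> x = 0"
  by (simp add: perp_def inner_vec_def sum_2)

lemma perp_inner_skew: "perp x \<bullet> y = - (perp y \<bullet> x)"
  by (simp add: perp_def inner_vec_def sum_2)

lemma perp_inner_perp: "perp x \<bullet> perp x = (norm x)\<^sup>2"
  by (metis norm_perp power2_norm_eq_inner)

lemma abs_perp_inner_le: "\<bar>perp x \<bullet> y\<bar> \<le> norm x * norm y"
  by (metis Cauchy_Schwarz_ineq2 norm_perp)

lemma continuous_on_perp [continuous_intros]:
  "continuous_on S f \<Longrightarrow> continuous_on S (\<lambda>x. perp (f x))"
proof -
  have "bounded_linear perp"
    by (rule bounded_linear_intro[where K = 1]) (simp_all add: perp_add perp_scaleR norm_perp)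
  then show "continuous_on S f \<Longrightarrow> continuous_on S (\<lambda>x. perp (f x))"
    by (rule bounded_linear.continuous_on)
qed

text \<open>Lagrange's identity: if the determinant vanishes, the Cauchy-Schwarz inequality is an
  equality, which forces collinearity.\<close>

lemma perp_inner_nonzero:
  assumes "\<not> collinear {0, u, v}"
  shows "perp u \<bullet> v \<noteq> 0"
proof
  assume *: "perp u \<bullet> v = 0"
  have "(u \<bullet> v)\<^sup>2 + (perp u \<bullet> v)\<^sup>2 = (u \<bullet> u) * (v \<bullet> v)"
    by (simp add: perp_def inner_vec_def sum_2 power2_eq_square algebra_simps)
  then have "(u \<bullet> v)\<^sup>2 = (norm u * norm v)\<^sup>2"
    by (simp add: * power_mult_distrib power2_norm_eq_inner)
  then have "\<bar>u \<bullet> v\<bar> = norm u * norm v"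
    by (metis abs_mult abs_norm_cancel power2_eq_iff_nonneg abs_ge_zero norm_ge_zero mult_nonneg_nonneg power2_abs)
  with assms show False by (simp add: norm_cauchy_schwarz_equal)
qed

lemma ex_small_factor:
  fixes a b :: real
  assumes "a > 0" "b \<ge> 0"
  obtains \<kappa> where "\<kappa> > 0" "\<kappa> * b < a"
proof (rule that)
  show "a / (b + 1) > 0" "a / (b + 1) * b < a" using assms by (simp_all add: field_simps)
qed

lemma connected_subset_component:
  assumes "connected Z" "Z \<noteq> {}" "Z \<inter> X = {}"
  obtains R where "R \<in> components (- X)" "Z \<subseteq> R"
proof -
  have "Z \<subseteq> - X" "- X \<noteq> {}" using assms by auto
  then show ?thesis using exists_component_superset[of Z "- X"] assms that by blast
qed

section \<open>Local shape of an immersed closed plane curve\<close>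

locale plane_loop =
  fixes c :: "real \<Rightarrow> real ^ 2"
  assumes immersed: "immersed_loop c"
begin

abbreviation velocity :: "real \<Rightarrow> real ^ 2" where
  "velocity t \<equiv> vector_derivative c (at t)"

lemma velocity_nonzero: "velocity t \<noteq> 0"
  using immersed by (simp add: immersed_loop_def)

lemma has_velocity: "(c has_vector_derivative velocity t) (at t)"
  and continuous_velocity: "continuous_on S velocity"
proof -
  obtain d where d: "d 0 = c" "\<And>(n::nat) t. (d n has_vector_derivative d (Suc n) t) (at t)"
    using immersed by (auto simp: immersed_loop_def smooth_loop_def smooth_def)
  have v: "velocity t = d 1 t" for t
    using d(2)[of 0 t] d(1) by (simp add: vector_derivative_at)
  show "(c has_vector_derivative velocity t) (at t)"
    unfolding v using d(2)[of 0 t] d(1) by simp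
  have "continuous_on S (d 1)"
    using d(2)[of 1] has_vector_derivative_continuous continuous_at_imp_continuous_on by blast
  then show "continuous_on S velocity" by (simp add: v[abs_def])
qed

lemma continuous_curve: "continuous_on S c"
  using has_velocity has_vector_derivative_continuous continuous_at_imp_continuous_on by blast

lemma curve_shift: "c (t + of_int k) = c t"
proof -
  have 1: "c (t + 1) = c t" for t
    using immersed by (simp add: immersed_loop_def smooth_loop_def)
  have nat: "c (t + of_nat n) = c t" for t n
    by (induction n) (use 1[of "t + of_nat n" for n] in \<open>simp_all add: add_ac\<close>)
  show ?thesis
  proof (cases "k \<ge> 0")
    case True
    then show ?thesis using nat[of t "nat k"] by simp
  next
    case False
    then show ?thesis using nat[of "t + of_int k" "nat (- k)"] by simp
  qed
qed

lemma velocity_shift: "velocity (t + of_int k) = velocity t"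
proof -
  have "((\<lambda>x. c (x + of_int k)) has_vector_derivative velocity (t + of_int k)) (at t)"
  proof -
    have "((\<lambda>x::real. x + of_int k) has_vector_derivative 1) (at t)"
      by (auto intro!: derivative_eq_intros)
    from vector_diff_chain_at[OF this, of c "velocity (t + of_int k)"] has_velocity[of "t + of_int k"]
    show ?thesis by (simp add: o_def)
  qed
  then show ?thesis by (simp add: curve_shift vector_derivative_at)
qed

text \<open>Strict differentiability, by continuity of the velocity: both endpoints may vary near
  \<open>t\<close>. Differentiability at \<open>t\<close> alone would control only chords through
  \<open>c t\<close>, whereas the chords below start at moving points.\<close>

lemma linearization:
  assumes "\<epsilon> > 0"
  obtains \<delta> where "\<delta> > 0"
    "\<And>r r'. dist r t < \<delta> \<Longrightarrow> dist r' t < \<delta> \<Longrightarrow>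
       norm (c r' - c r - (r' - r) *\<^sub>R velocity t) \<le> \<epsilon> * \<bar>r' - r\<bar>"
proof -
  obtain \<delta> where \<delta>: "\<delta> > 0" "\<And>x. dist x t < \<delta> \<Longrightarrow> dist (velocity x) (velocity t) < \<epsilon>"
    using continuous_velocity[of UNIV] assms unfolding continuous_on_iff by blast
  show ?thesis
  proof (rule that[OF \<delta>(1)])
    fix r r' assume r: "dist r t < \<delta>" "dist r' t < \<delta>"
    have "closed_segment r r' \<subseteq> ball t \<delta>"
      by (rule closed_segment_subset) (use r in \<open>auto simp: dist_commute\<close>)
    then have "norm (c r' - c r - (r' - r) *\<^sub>R velocity t) \<le> norm (r' - r) * \<epsilon>"
    proof (intro vector_differentiable_bound_linearization[of "ball t \<delta>" c velocity])
      show "norm (velocity x - velocity t) \<le> \<epsilon>" if x: "x \<in> ball t \<delta>" for x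
      proof -
        have "dist x t < \<delta>" using x by (simp add: dist_commute)
        then show ?thesis using \<delta>(2)[of x] by (metis dist_norm less_imp_le)
      qed
    qed (use \<delta>(1) in \<open>auto intro: has_vector_derivative_at_within has_velocity\<close>)
    then show "norm (c r' - c r - (r' - r) *\<^sub>R velocity t) \<le> \<epsilon> * \<bar>r' - r\<bar>"
      by (simp add: mult.commute)
  qed
qed

text \<open>All short chords near \<open>t\<close> lie in a thin double cone around the tangent
  line. A vector outside the cone is never such a chord: this is how segments leaving the curve are
  shown not to hit the same strand again.\<close>

lemma chord_cone:
  assumes "\<kappa> > 0"
  obtains \<delta> where "\<delta> > 0"
    "\<And>r r'. dist r t < \<delta> \<Longrightarrow> dist r' t < \<delta> \<Longrightarrow>
       \<bar>perp (velocity t) \<bullet> (c r' - c r)\<bar> \<le> \<kappa> * norm (c r' - c r)"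
proof -
  define w where "w = velocity t"
  have w: "norm w > 0" using velocity_nonzero by (simp add: w_def)
  \<comment> \<open>The bound \<open>norm w / 2\<close> makes the parameter difference comparable to
    the chord length, up to a factor 2 that \<open>\<kappa> / 2\<close> absorbs.\<close>
  define \<epsilon> where "\<epsilon> = min (\<kappa> / 2) (norm w / 2)"
  have \<epsilon>: "\<epsilon> > 0" "2 * \<epsilon> \<le> \<kappa>" "2 * \<epsilon> \<le> norm w" using assms w by (auto simp: \<epsilon>_def)
  obtain \<delta> where \<delta>: "\<delta> > 0" and lin: "\<And>r r'. dist r t < \<delta> \<Longrightarrow> dist r' t < \<delta> \<Longrightarrow>
       norm (c r' - c r - (r' - r) *\<^sub>R velocity t) \<le> \<epsilon> * \<bar>r' - r\<bar>"
    using linearization[OF \<epsilon>(1)] by blast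
  show ?thesis
  proof (rule that[OF \<delta>])
    fix r r' assume r: "dist r t < \<delta>" "dist r' t < \<delta>"
    define h where "h = c r' - c r - (r' - r) *\<^sub>R w"
    define m where "m = c r' - c r"
    have h: "norm h \<le> \<epsilon> * \<bar>r' - r\<bar>" using lin[OF r] by (simp add: h_def w_def)
    have m: "m = (r' - r) *\<^sub>R w + h" by (simp add: h_def m_def)
    have "norm ((r' - r) *\<^sub>R w) \<le> norm m + norm h"
      using norm_triangle_ineq4[of m h] by (simp add: m)
    then have "\<bar>r' - r\<bar> * norm w \<le> norm m + \<epsilon> * \<bar>r' - r\<bar>" using h by simp
    also have "\<epsilon> * \<bar>r' - r\<bar> \<le> norm w / 2 * \<bar>r' - r\<bar>" using \<epsilon> by (intro mult_right_mono) auto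
    finally have m_ge: "\<bar>r' - r\<bar> * norm w \<le> 2 * norm m" by (simp add: field_simps)
    have "\<bar>perp w \<bullet> m\<bar> = \<bar>perp w \<bullet> h\<bar>" by (simp add: m inner_add_right perp_inner_self)
    also have "\<dots> \<le> norm w * norm h" by (rule abs_perp_inner_le)
    also have "\<dots> \<le> norm w * (\<epsilon> * \<bar>r' - r\<bar>)" using h by (intro mult_left_mono) auto
    also have "\<dots> = \<epsilon> * (\<bar>r' - r\<bar> * norm w)" by simp
    also have "\<dots> \<le> \<epsilon> * (2 * norm m)" using m_ge \<epsilon> by (intro mult_left_mono) auto
    also have "\<dots> \<le> \<kappa> * norm m" using \<epsilon>(2) mult_right_mono[of "2 * \<epsilon>" \<kappa> "norm m"] by (simp add: mult_ac)
    finally show "\<bar>perp (velocity t) \<bullet> (c r' - c r)\<bar> \<le> \<kappa> * norm (c r' - c r)"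
      by (simp add: m_def w_def)
  qed
qed

text \<open>Compactness of a period: the parameters away from the preimages of \<open>P\<close> have
  a compact image that misses \<open>P\<close>. Balls around all real preimages are removed, so that
  a preimage just outside the period still counts near its ends.\<close>

lemma near_preimage:
  assumes "\<delta> > 0"
  obtains \<rho> where "\<rho> > 0" "\<And>r. dist (c r) P < \<rho> \<Longrightarrow> \<exists>t. c t = P \<and> dist r t < \<delta>"
proof -
  define K where "K = {0..1} - (\<Union>t\<in>{t. c t = P}. ball t \<delta>)"
  have "compact K" unfolding K_def by (intro compact_diff compact_Icc open_UN) auto
  then have "closed (c ` K)"
    by (intro compact_imp_closed compact_continuous_image continuous_curve)
  moreover have "P \<notin> c ` K" using assms by (auto simp: K_def)
  ultimately obtain \<rho> where \<rho>: "\<rho> > 0" "\<forall>x. dist x P < \<rho> \<longrightarrow> x \<notin> c ` K"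
    unfolding closed_def open_dist by (metis Compl_iff)
  show ?thesis
  proof (rule that[OF \<rho>(1)])
    fix r assume r: "dist (c r) P < \<rho>"
    have cf: "c (frac r) = c r" using curve_shift[of "frac r" "\<lfloor>r\<rfloor>"] by (simp add: frac_def)
    then have "frac r \<notin> K" using \<rho>(2) r by (metis image_eqI)
    moreover have "frac r \<in> {0..1}" using frac_lt_1[of r] by auto
    ultimately obtain t where t: "c t = P" "dist (frac r) t < \<delta>"
      by (auto simp: K_def dist_commute)
    have "dist r (t + of_int \<lfloor>r\<rfloor>) = dist (frac r) t" by (simp add: frac_def dist_real_def algebra_simps)
    then show "\<exists>t. c t = P \<and> dist r t < \<delta>"
      using t curve_shift[of t "\<lfloor>r\<rfloor>"] by metis
  qed
qed

text \<open>The same description as in \<open>corner_region\<close>, with \<open>n\<close>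
  arbitrary, so that sides of arcs and corners of crossings become values of one function.\<close>

definition side :: "real \<Rightarrow> real ^ 2 \<Rightarrow> (real ^ 2) set" where
  "side r n = (THE R. R \<in> components (- range c) \<and> (\<forall>\<^sub>F e in at_right 0. c r + e *\<^sub>R n \<in> R))"

lemma side_eqI:
  assumes R: "R \<in> components (- range c)" and "\<delta> > 0"
    and in_R: "\<And>e. 0 < e \<Longrightarrow> e < \<delta> \<Longrightarrow> c r + e *\<^sub>R n \<in> R"
  shows "side r n = R"
  unfolding side_def
proof (rule the_equality)
  have ev: "\<forall>\<^sub>F e in at_right 0. c r + e *\<^sub>R n \<in> R"
    by (rule eventually_at_rightI[of 0 \<delta>]) (use assms in auto)
  then show "R \<in> components (- range c) \<and> (\<forall>\<^sub>F e in at_right 0. c r + e *\<^sub>R n \<in> R)"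
    using R by simp
  fix R' assume R': "R' \<in> components (- range c) \<and> (\<forall>\<^sub>F e in at_right 0. c r + e *\<^sub>R n \<in> R')"
  then have "\<forall>\<^sub>F e in at_right (0::real). c r + e *\<^sub>R n \<in> R \<inter> R'"
    using ev by (auto elim: eventually_elim2)
  then have "R \<inter> R' \<noteq> {}"
    using eventually_happens[of _ "at_right (0::real)"] by fastforce
  then show "R' = R" using components_eq R R' by blast
qed

text \<open>Parameters live on the whole line and are compared modulo the period, so that the ends
  of a period need no special treatment.\<close>

definition simple_point :: "real \<Rightarrow> bool" where
  "simple_point r \<longleftrightarrow> (\<forall>r'. c r' = c r \<longrightarrow> r' - r \<in> \<int>)"

definition double_point :: "real \<Rightarrow> real \<Rightarrow> bool" where
  "double_point s t \<longleftrightarrow> c s = c t \<and> perp (velocity s) \<bullet> velocity t \<noteq> 0 \<and>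
     (\<forall>r. c r = c s \<longrightarrow> r - s \<in> \<int> \<or> r - t \<in> \<int>)"

lemma reparametrize_near:
  assumes "t - t0 \<in> \<int>" "dist r t < \<delta>"
  shows "\<exists>r'. c r' = c r \<and> dist r' t0 < \<delta>"
proof -
  obtain k where k: "t - t0 = of_int k" using assms(1) by (auto elim: Ints_cases)
  have "c (r + of_int (- k)) = c r" by (rule curve_shift)
  moreover have "dist (r + of_int (- k)) t0 = dist r t" using k by (simp add: dist_real_def)
  ultimately show ?thesis using assms(2) by metis
qed

lemma near_simple_point:
  assumes "simple_point t" "\<delta> > 0"
  obtains \<rho> where "\<rho> > 0" "\<And>r. dist (c r) (c t) < \<rho> \<Longrightarrow> \<exists>r'. c r' = c r \<and> dist r' t < \<delta>"
proof -
  obtain \<rho> where "\<rho> > 0" "\<And>r. dist (c r) (c t) < \<rho> \<Longrightarrow> \<exists>t'. c t' = c t \<and> dist r t' < \<delta>"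
    using near_preimage[OF assms(2)] by blast
  then show ?thesis using that assms(1) reparametrize_near unfolding simple_point_def by metis
qed

lemma near_double_point:
  assumes "double_point s t" "\<delta> > 0"
  obtains \<rho> where "\<rho> > 0"
    "\<And>r. dist (c r) (c s) < \<rho> \<Longrightarrow> \<exists>r'. c r' = c r \<and> (dist r' s < \<delta> \<or> dist r' t < \<delta>)"
proof -
  obtain \<rho> where "\<rho> > 0" "\<And>r. dist (c r) (c s) < \<rho> \<Longrightarrow> \<exists>t'. c t' = c s \<and> dist r t' < \<delta>"
    using near_preimage[OF assms(2)] by blast
  then show ?thesis using that assms(1) reparametrize_near unfolding double_point_def by metis
qed

lemma double_point_swap: "double_point s t \<Longrightarrow> double_point t s"
  unfolding double_point_def by (metis perp_inner_skew neg_equal_0_iff_equal)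

lemma double_point_shift: "double_point s t \<Longrightarrow> double_point (s + of_int k) t"
proof -
  assume *: "double_point s t"
  have "r - (s + of_int k) \<in> \<int>" if "r - s \<in> \<int>" for r
    using Ints_diff[OF that Ints_of_int[of k]] by (simp add: algebra_simps)
  with * show ?thesis unfolding double_point_def curve_shift velocity_shift by blast
qed

text \<open>The points \<open>c r + e *\<^sub>R n\<close> with \<open>(r, n, e)\<close> in a small
  half ball, \<open>e > 0\<close>, form a connected set. It misses the curve, since
  \<open>e *\<^sub>R n\<close> would otherwise be a short chord outside the cone; so it lies in one
  region.\<close>

lemma side_locally_constant:
  assumes simple: "simple_point t" and n0: "perp (velocity t) \<bullet> n0 \<noteq> 0"
  obtains \<delta> R where "\<delta> > 0" "R \<in> components (- range c)"
    "\<And>r n. dist r t < \<delta> \<Longrightarrow> dist n n0 < \<delta> \<Longrightarrow> side r n = R"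
proof -
  define w where "w = velocity t"
  obtain \<kappa> where \<kappa>: "\<kappa> > 0" "\<kappa> * norm n0 < \<bar>perp w \<bullet> n0\<bar>"
    using ex_small_factor[of "\<bar>perp w \<bullet> n0\<bar>" "norm n0"] n0 by (auto simp: w_def)
  obtain \<delta>1 where \<delta>1: "\<delta>1 > 0" "\<And>r r'. dist r t < \<delta>1 \<Longrightarrow> dist r' t < \<delta>1 \<Longrightarrow>
       \<bar>perp w \<bullet> (c r' - c r)\<bar> \<le> \<kappa> * norm (c r' - c r)"
    using chord_cone[OF \<kappa>(1), of t] unfolding w_def by blast
  obtain \<rho> where \<rho>: "\<rho> > 0" "\<And>r. dist (c r) (c t) < \<rho> \<Longrightarrow> \<exists>r'. c r' = c r \<and> dist r' t < \<delta>1"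
    using near_simple_point[OF simple \<delta>1(1)] by blast
  define V where "V = {(r, n, e). dist r t < \<delta>1 \<and> dist (c r + e *\<^sub>R n) (c t) < \<rho> \<and> \<kappa> * norm n < \<bar>perp w \<bullet> n\<bar>}"
  have cont: "continuous_on UNIV (\<lambda>x. c (fst x))"
    by (rule continuous_on_compose2[OF continuous_curve[of UNIV]]) (auto intro: continuous_intros)
  have "open V" unfolding V_def case_prod_beta
    by (intro open_Collect_conj open_Collect_less continuous_intros cont)
  moreover have "(t, n0, 0) \<in> V" using \<delta>1 \<rho> \<kappa> by (simp add: V_def)
  ultimately obtain \<eta> where \<eta>: "\<eta> > 0" "ball (t, n0, 0 :: real) \<eta> \<subseteq> V" by (meson openE)
  define T where "T = ball (t, n0, 0 :: real) \<eta> \<inter> (UNIV \<times> UNIV \<times> {0<..})"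
  define Z where "Z = (\<lambda>(r, n, e). c r + e *\<^sub>R n) ` T"
  have "convex ((UNIV :: real set) \<times> (UNIV :: (real ^ 2) set) \<times> {0 :: real<..})"
    by (intro convex_Times convex_UNIV convex_real_interval)
  then have "connected T" unfolding T_def by (intro convex_connected convex_Int convex_ball)
  then have "connected Z" unfolding Z_def case_prod_beta
    by (rule connected_continuous_image[rotated])
      (intro continuous_intros continuous_on_subset[OF cont]; simp)
  moreover have "(t, n0, \<eta> / 2) \<in> T" using \<eta> by (simp add: T_def dist_Pair_Pair)
  then have "Z \<noteq> {}" by (auto simp: Z_def)
  moreover have "Z \<inter> range c = {}"
  proof (rule ccontr)
    assume "Z \<inter> range c \<noteq> {}"
    then obtain y where y: "y \<in> Z" "y \<in> range c" by blast
    then obtain r n e where "(r, n, e) \<in> T" "y = c r + e *\<^sub>R n" by (auto simp: Z_def)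
    moreover obtain r' where "y = c r'" using y by blast
    ultimately have *: "(r, n, e) \<in> T" "c r' = c r + e *\<^sub>R n" by simp_all
    then have V: "(r, n, e) \<in> V" and e: "e > 0" using \<eta> by (auto simp: T_def)
    then obtain r'' where r'': "c r'' = c r'" "dist r'' t < \<delta>1"
      using \<rho>(2)[of r'] *(2) by (auto simp: V_def)
    have "\<bar>perp w \<bullet> (e *\<^sub>R n)\<bar> \<le> \<kappa> * norm (e *\<^sub>R n)"
      using \<delta>1(2)[of r r''] V r'' *(2) by (simp add: V_def)
    then have "e * \<bar>perp w \<bullet> n\<bar> \<le> e * (\<kappa> * norm n)" using e by (simp add: abs_mult mult_ac)
    then show False using V e by (simp add: V_def)
  qed
  ultimately obtain R where R: "R \<in> components (- range c)" "Z \<subseteq> R"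
    using connected_subset_component by blast
  show ?thesis
  proof (rule that[of "\<eta> / 3", OF _ R(1)])
    fix r n assume rn: "dist r t < \<eta> / 3" "dist n n0 < \<eta> / 3"
    show "side r n = R"
    proof (rule side_eqI[OF R(1), of "\<eta> / 3"])
      fix e :: real assume e: "0 < e" "e < \<eta> / 3"
      have "dist (r, n, e) (t, n0, 0) \<le> dist r t + dist (n, e) (n0, 0)"
        by (simp add: dist_Pair_Pair[of r] sqrt_sum_squares_le_sum)
      also have "\<dots> \<le> dist r t + (dist n n0 + dist e 0)"
        using sqrt_sum_squares_le_sum_abs[of "dist n n0" e] by (simp add: dist_Pair_Pair[of n])
      also have "\<dots> < \<eta>" using rn e by simp
      finally have "(r, n, e) \<in> T" using e by (simp add: T_def dist_commute)
      then show "c r + e *\<^sub>R n \<in> R" using R(2) by (force simp: Z_def)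
    qed (use \<eta> in auto)
  qed (use \<eta> in auto)
qed

lemma side_cong: "c r = c r' \<Longrightarrow> side r n = side r' n"
  by (simp add: side_def)

text \<open>The argument of the simple case, with directions outside the cones of both strands. The
  base point stays at the crossing: from a nearby point of one strand, direction \<open>n\<close>
  may run into the other.\<close>

lemma side_at_double_point:
  assumes dp: "double_point s t"
    and n0: "perp (velocity s) \<bullet> n0 \<noteq> 0" "perp (velocity t) \<bullet> n0 \<noteq> 0"
  obtains \<delta> R where "\<delta> > 0" "R \<in> components (- range c)"
    "\<And>n e. dist n n0 < \<delta> \<Longrightarrow> 0 < e \<Longrightarrow> e < \<delta> \<Longrightarrow> c s + e *\<^sub>R n \<in> R"
proof -
  define u v where "u = velocity s" and "v = velocity t"
  have st: "c s = c t" using dp by (simp add: double_point_def)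
  obtain \<kappa> where \<kappa>: "\<kappa> > 0" "\<kappa> * norm n0 < min \<bar>perp u \<bullet> n0\<bar> \<bar>perp v \<bullet> n0\<bar>"
    using ex_small_factor[of "min \<bar>perp u \<bullet> n0\<bar> \<bar>perp v \<bullet> n0\<bar>" "norm n0"] n0
    by (auto simp: u_def v_def)
  obtain \<delta>1 where \<delta>1: "\<delta>1 > 0" "\<And>r r'. dist r s < \<delta>1 \<Longrightarrow> dist r' s < \<delta>1 \<Longrightarrow>
       \<bar>perp u \<bullet> (c r' - c r)\<bar> \<le> \<kappa> * norm (c r' - c r)"
    using chord_cone[OF \<kappa>(1), of s] unfolding u_def by blast
  obtain \<delta>2 where \<delta>2: "\<delta>2 > 0" "\<And>r r'. dist r t < \<delta>2 \<Longrightarrow> dist r' t < \<delta>2 \<Longrightarrow>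
       \<bar>perp v \<bullet> (c r' - c r)\<bar> \<le> \<kappa> * norm (c r' - c r)"
    using chord_cone[OF \<kappa>(1), of t] unfolding v_def by blast
  have "min \<delta>1 \<delta>2 > 0" using \<delta>1 \<delta>2 by simp
  then obtain \<rho> where \<rho>: "\<rho> > 0"
    "\<And>r. dist (c r) (c s) < \<rho> \<Longrightarrow> \<exists>r'. c r' = c r \<and> (dist r' s < min \<delta>1 \<delta>2 \<or> dist r' t < min \<delta>1 \<delta>2)"
    using near_double_point[OF dp] by blast
  define V where "V = {(n, e). dist (c s + e *\<^sub>R n) (c s) < \<rho> \<and>
      \<kappa> * norm n < \<bar>perp u \<bullet> n\<bar> \<and> \<kappa> * norm n < \<bar>perp v \<bullet> n\<bar>}"
  have "open V" unfolding V_def case_prod_beta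
    by (intro open_Collect_conj open_Collect_less continuous_intros)
  moreover have "(n0, 0) \<in> V" using \<rho> \<kappa> by (simp add: V_def)
  ultimately obtain \<eta> where \<eta>: "\<eta> > 0" "ball (n0, 0 :: real) \<eta> \<subseteq> V" by (meson openE)
  define T where "T = ball (n0, 0 :: real) \<eta> \<inter> (UNIV \<times> {0<..})"
  define Z where "Z = (\<lambda>(n, e). c s + e *\<^sub>R n) ` T"
  have "convex ((UNIV :: (real ^ 2) set) \<times> {0 :: real<..})"
    by (intro convex_Times convex_UNIV convex_real_interval)
  then have "connected T" unfolding T_def by (intro convex_connected convex_Int convex_ball)
  then have "connected Z" unfolding Z_def case_prod_beta
    by (rule connected_continuous_image[rotated]) (intro continuous_intros)
  moreover have "(n0, \<eta> / 2) \<in> T" using \<eta> by (simp add: T_def dist_Pair_Pair)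
  then have "Z \<noteq> {}" by (auto simp: Z_def)
  moreover have "Z \<inter> range c = {}"
  proof (rule ccontr)
    assume "Z \<inter> range c \<noteq> {}"
    then obtain y where y: "y \<in> Z" "y \<in> range c" by blast
    then obtain n e where "(n, e) \<in> T" "y = c s + e *\<^sub>R n" by (auto simp: Z_def)
    moreover obtain r' where "y = c r'" using y by blast
    ultimately have *: "(n, e) \<in> T" "c r' = c s + e *\<^sub>R n" by simp_all
    then have V: "(n, e) \<in> V" and e: "e > 0" using \<eta> by (auto simp: T_def)
    have "dist (c r') (c s) < \<rho>" using V by (simp add: V_def *(2))
    then obtain r'' where r'': "c r'' = c r'" "dist r'' s < \<delta>1 \<or> dist r'' t < \<delta>2"
      using \<rho>(2)[of r'] by auto
    then have "\<bar>perp u \<bullet> (e *\<^sub>R n)\<bar> \<le> \<kappa> * norm (e *\<^sub>R n) \<or> \<bar>perp v \<bullet> (e *\<^sub>R n)\<bar> \<le> \<kappa> * norm (e *\<^sub>R n)"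
      using \<delta>1(2)[of s r''] \<delta>2(2)[of t r''] \<delta>1(1) \<delta>2(1) *(2) st by auto
    then have "e * \<bar>perp u \<bullet> n\<bar> \<le> e * (\<kappa> * norm n) \<or> e * \<bar>perp v \<bullet> n\<bar> \<le> e * (\<kappa> * norm n)"
      using e by (simp add: abs_mult mult_ac)
    then show False using V e by (auto simp: V_def)
  qed
  ultimately obtain R where R: "R \<in> components (- range c)" "Z \<subseteq> R"
    using connected_subset_component by blast
  show ?thesis
  proof (rule that[of "\<eta> / 2", OF _ R(1)])
    fix n and e :: real assume ne: "dist n n0 < \<eta> / 2" "0 < e" "e < \<eta> / 2"
    have "dist (n, e) (n0, 0) \<le> dist n n0 + \<bar>e\<bar>"
      using sqrt_sum_squares_le_sum_abs[of "dist n n0" e] by (simp add: dist_Pair_Pair[of n])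
    also have "\<dots> < \<eta>" using ne by simp
    finally have "(n, e) \<in> T" using ne by (simp add: T_def dist_commute)
    then show "c s + e *\<^sub>R n \<in> R" using R(2) by (force simp: Z_def)
  qed (use \<eta> in auto)
qed

lemma side_at_double_point_in_components:
  assumes "double_point s t" "perp (velocity s) \<bullet> n \<noteq> 0" "perp (velocity t) \<bullet> n \<noteq> 0"
  shows "side s n \<in> components (- range c)"
proof -
  obtain \<delta> R where *: "\<delta> > 0" "R \<in> components (- range c)"
    "\<And>n' e. dist n' n < \<delta> \<Longrightarrow> 0 < e \<Longrightarrow> e < \<delta> \<Longrightarrow> c s + e *\<^sub>R n' \<in> R"
    using side_at_double_point[OF assms] by blast
  then have "side s n = R" by (intro side_eqI[of _ \<delta>]) auto
  with * show ?thesis by simp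
qed

text \<open>Moving from the crossing along the strand at \<open>s\<close> by the parameter distance
  \<open>\<tau>\<close>, and then by \<open>\<tau>\<close> times \<open>\<beta> v\<close>, leads up
  to a small error to \<open>c s + \<tau> (\<sigma> u + \<beta> v)\<close>, a point of the corner.
  It remains to see that the second segment meets no strand.\<close>

lemma side_near_double_point:
  fixes \<beta> \<sigma> :: real
  assumes dp: "double_point s t" and \<beta>: "\<bar>\<beta>\<bar> = 1" and \<sigma>: "\<bar>\<sigma>\<bar> = 1"
  obtains \<delta> where "\<delta> > 0" "\<And>r. dist r s < \<delta> \<Longrightarrow> sgn (r - s) = \<sigma> \<Longrightarrow>
      side r (\<beta> *\<^sub>R velocity t) = side s (\<sigma> *\<^sub>R velocity s + \<beta> *\<^sub>R velocity t)"
proof -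
  define u v n0 where "u = velocity s" and "v = velocity t" and "n0 = \<sigma> *\<^sub>R u + \<beta> *\<^sub>R v"
  have st: "c s = c t" using dp by (simp add: double_point_def)
  define X where "X = \<bar>perp u \<bullet> v\<bar>"
  have X: "X > 0" "\<bar>perp v \<bullet> u\<bar> = X"
    using dp perp_inner_skew[of u v] by (auto simp: double_point_def X_def u_def v_def)
  have n0: "perp (velocity s) \<bullet> n0 \<noteq> 0" "perp (velocity t) \<bullet> n0 \<noteq> 0"
    using X \<beta> \<sigma> by (auto simp: n0_def inner_add_right perp_inner_self X_def simp flip: u_def v_def)
  obtain \<delta>0 R where \<delta>0: "\<delta>0 > 0" and R: "R \<in> components (- range c)"
    "\<And>n e. dist n n0 < \<delta>0 \<Longrightarrow> 0 < e \<Longrightarrow> e < \<delta>0 \<Longrightarrow> c s + e *\<^sub>R n \<in> R"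
    using side_at_double_point[OF dp n0] by blast
  have side_s: "side s n0 = R" by (rule side_eqI[OF R(1) \<delta>0]) (use R(2) \<delta>0 in auto)
  obtain \<kappa> where \<kappa>: "\<kappa> > 0" "\<kappa> * (norm u + 1 + 3 * norm v) < X"
    using ex_small_factor[OF X(1), of "norm u + 1 + 3 * norm v"] by auto
  define \<epsilon> where "\<epsilon> = min (min \<kappa> 1) (\<delta>0 / 2)"
  have \<epsilon>: "\<epsilon> > 0" "\<epsilon> \<le> \<kappa>" "\<epsilon> \<le> 1" "\<epsilon> < \<delta>0" using \<kappa> \<delta>0 by (auto simp: \<epsilon>_def)
  obtain \<delta>1 where \<delta>1: "\<delta>1 > 0" "\<And>r r'. dist r s < \<delta>1 \<Longrightarrow> dist r' s < \<delta>1 \<Longrightarrow>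
       norm (c r' - c r - (r' - r) *\<^sub>R u) \<le> \<epsilon> * \<bar>r' - r\<bar>"
    using linearization[OF \<epsilon>(1), of s] unfolding u_def by blast
  obtain \<delta>2 where \<delta>2: "\<delta>2 > 0" "\<And>r r'. dist r s < \<delta>2 \<Longrightarrow> dist r' s < \<delta>2 \<Longrightarrow>
       \<bar>perp u \<bullet> (c r' - c r)\<bar> \<le> \<kappa> * norm (c r' - c r)"
    using chord_cone[OF \<kappa>(1), of s] unfolding u_def by blast
  obtain \<delta>3 where \<delta>3: "\<delta>3 > 0" "\<And>r r'. dist r t < \<delta>3 \<Longrightarrow> dist r' t < \<delta>3 \<Longrightarrow>
       \<bar>perp v \<bullet> (c r' - c r)\<bar> \<le> \<kappa> * norm (c r' - c r)"
    using chord_cone[OF \<kappa>(1), of t] unfolding v_def by blast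
  have "min \<delta>2 \<delta>3 > 0" using \<delta>2 \<delta>3 by simp
  then obtain \<rho> where \<rho>: "\<rho> > 0"
    "\<And>r. dist (c r) (c s) < \<rho> \<Longrightarrow> \<exists>r'. c r' = c r \<and> (dist r' s < min \<delta>2 \<delta>3 \<or> dist r' t < min \<delta>2 \<delta>3)"
    using near_double_point[OF dp] by blast
  \<comment> \<open>Bounds, in units of \<open>\<tau>\<close>, how far points of the segment are
    from the crossing; the radius \<open>\<rho> / q\<close> keeps them where only the two strands
    occur.\<close>
  define q where "q = norm u + 1 + norm v"
  have q: "q > 0" unfolding q_def by (simp add: add_nonneg_pos add_pos_nonneg)
  define \<delta> where "\<delta> = min (min \<delta>0 \<delta>1) (min \<delta>2 (\<rho> / q))"
  have \<delta>: "\<delta> > 0" "\<delta> \<le> \<delta>0" "\<delta> \<le> \<delta>1" "\<delta> \<le> \<delta>2" "\<delta> \<le> \<rho> / q"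
    using \<delta>0 \<delta>1(1) \<delta>2(1) \<rho>(1) q by (auto simp: \<delta>_def)
  show ?thesis
  proof (rule that[OF \<delta>(1)])
    fix r assume r: "dist r s < \<delta>" "sgn (r - s) = \<sigma>"
    define \<tau> where "\<tau> = \<bar>r - s\<bar>"
    have \<tau>: "\<tau> > 0" "\<tau> < \<delta>" "r - s = \<tau> * \<sigma>"
      using r \<sigma> mult_sgn_abs[of "r - s"] by (auto simp: \<tau>_def dist_real_def mult.commute)
    define h where "h = c r - c s - (r - s) *\<^sub>R u"
    have h: "norm h \<le> \<epsilon> * \<tau>"
      using \<delta>1(2)[of s r] \<delta>1(1) r(1) \<delta>(3) by (simp add: h_def \<tau>_def)
    define Z where "Z = (\<lambda>e. c r + e *\<^sub>R \<beta> *\<^sub>R v) ` {0<..\<tau>}"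
    have "connected Z" unfolding Z_def
      by (intro connected_continuous_image continuous_intros) simp
    moreover have "Z \<subseteq> - range c"
    proof (rule ccontr)
      assume "\<not> Z \<subseteq> - range c"
      then obtain y where y: "y \<in> Z" "y \<in> range c" by blast
      then obtain e where e: "0 < e" "e \<le> \<tau>" "y = c r + e *\<^sub>R \<beta> *\<^sub>R v" by (auto simp: Z_def)
      moreover obtain r' where "y = c r'" using y by blast
      ultimately have r': "c r' = c r + e *\<^sub>R \<beta> *\<^sub>R v" by simp
      define m where "m = c r' - c s"
      have m: "m = (r - s) *\<^sub>R u + h + e *\<^sub>R \<beta> *\<^sub>R v" by (simp add: m_def r' h_def)
      have "norm m \<le> norm ((r - s) *\<^sub>R u) + norm h + norm (e *\<^sub>R \<beta> *\<^sub>R v)"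
        unfolding m by (rule order_trans[OF norm_triangle_ineq add_right_mono[OF norm_triangle_ineq]])
      also have "\<dots> \<le> \<tau> * norm u + \<tau> * 1 + \<tau> * norm v"
      proof (intro add_mono)
        show "norm ((r - s) *\<^sub>R u) \<le> \<tau> * norm u" by (simp add: \<tau>_def)
        show "norm h \<le> \<tau> * 1"
          using h mult_right_mono[OF \<epsilon>(3) less_imp_le[OF \<tau>(1)]] by linarith
        have "norm (e *\<^sub>R \<beta> *\<^sub>R v) = e * norm v" using e(1) \<beta> by (simp add: abs_mult)
        then show "norm (e *\<^sub>R \<beta> *\<^sub>R v) \<le> \<tau> * norm v" using mult_right_mono[OF e(2) norm_ge_zero[of v]] by linarith
      qed
      finally have m_le: "norm m \<le> \<tau> * q" by (simp add: q_def algebra_simps)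
      also have "\<dots> < \<delta> * q" using \<tau>(2) q by simp
      also have "\<dots> \<le> \<rho>" using \<delta>(5) q by (simp add: pos_le_divide_eq)
      finally have "dist (c r') (c s) < \<rho>" by (simp add: m_def dist_norm)
      then obtain r'' where r'': "c r'' = c r'" "dist r'' s < \<delta>2 \<or> dist r'' t < \<delta>3"
        using \<rho>(2)[of r'] by auto
      \<comment> \<open>On the strand at \<open>s\<close> the hit would give a chord parallel to
        \<open>v\<close>; on the strand at \<open>t\<close>, a chord from the crossing whose
        determinant with \<open>v\<close> has size about \<open>\<tau> * X\<close>. Both lie outside
        the respective cones, by the choice of \<open>\<kappa>\<close>.\<close>
      from r''(2) show False
      proof
        assume "dist r'' s < \<delta>2"
        then have "\<bar>perp u \<bullet> (e *\<^sub>R \<beta> *\<^sub>R v)\<bar> \<le> \<kappa> * norm (e *\<^sub>R \<beta> *\<^sub>R v)"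
          using \<delta>2(2)[of r r''] r(1) \<delta>(4) by (simp add: r'' r')
        then have "e * X \<le> e * (\<kappa> * norm v)" using e \<beta> by (simp add: abs_mult X_def mult_ac)
        then have "X \<le> \<kappa> * norm v" using e by simp
        moreover have "\<kappa> * norm v \<le> \<kappa> * (norm u + 1 + 3 * norm v)"
          using \<kappa>(1) by (intro mult_left_mono) (auto intro: add_nonneg_nonneg)
        ultimately show False using \<kappa>(2) by simp
      next
        assume "dist r'' t < \<delta>3"
        then have "\<bar>perp v \<bullet> m\<bar> \<le> \<kappa> * norm m"
          using \<delta>3(2)[of t r''] \<delta>3(1) by (simp add: r'' m_def st)
        also have "\<dots> \<le> \<kappa> * (\<tau> * q)" using m_le \<kappa>(1) by (intro mult_left_mono) auto
        finally have 1: "\<bar>perp v \<bullet> m\<bar> \<le> \<kappa> * (\<tau> * q)" .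
        have "\<bar>perp v \<bullet> h\<bar> \<le> norm v * (\<epsilon> * \<tau>)"
          by (rule order_trans[OF abs_perp_inner_le mult_left_mono[OF h]]) simp
        also have "\<dots> \<le> norm v * (\<kappa> * \<tau>)"
          using \<epsilon>(2) \<tau>(1) by (intro mult_left_mono mult_right_mono) auto
        finally have 2: "\<bar>perp v \<bullet> h\<bar> \<le> norm v * (\<kappa> * \<tau>)" .
        have "perp v \<bullet> m = (r - s) * (perp v \<bullet> u) + perp v \<bullet> h"
          by (simp add: m inner_add_right perp_inner_self)
        moreover have "\<bar>(r - s) * (perp v \<bullet> u)\<bar> = \<tau> * X" by (simp add: abs_mult X \<tau>_def)
        ultimately have "\<tau> * X \<le> \<kappa> * (\<tau> * q) + norm v * (\<kappa> * \<tau>)" using 1 2 by linarith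
        then have "\<tau> * X \<le> \<tau> * (\<kappa> * (q + norm v))" by (simp add: algebra_simps)
        then have "X \<le> \<kappa> * (q + norm v)" using \<tau>(1) by simp
        also have "\<dots> \<le> \<kappa> * (norm u + 1 + 3 * norm v)"
          using \<kappa>(1) by (intro mult_left_mono) (auto simp: q_def)
        finally show False using \<kappa>(2) by simp
      qed
    qed
    \<comment> \<open>Divided by \<open>\<tau>\<close>, the error \<open>h\<close> becomes a
      perturbation of the direction \<open>n0\<close> of size at most \<open>\<epsilon>\<close>,
      which the corner region tolerates.\<close>
    moreover have "c r + \<tau> *\<^sub>R \<beta> *\<^sub>R v \<in> R \<inter> Z"
    proof
      have "dist (n0 + (1 / \<tau>) *\<^sub>R h) n0 \<le> \<epsilon>"
        using h \<tau>(1) by (simp add: dist_norm field_simps)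
      then have "c s + \<tau> *\<^sub>R (n0 + (1 / \<tau>) *\<^sub>R h) \<in> R"
        using \<epsilon>(4) \<tau> \<delta>(2) by (intro R(2)) auto
      also have "c s + \<tau> *\<^sub>R (n0 + (1 / \<tau>) *\<^sub>R h) = c r + \<tau> *\<^sub>R \<beta> *\<^sub>R v"
        using \<tau>(1) by (simp add: n0_def h_def \<tau>(3) scaleR_add_right)
      finally show "c r + \<tau> *\<^sub>R \<beta> *\<^sub>R v \<in> R" .
    qed (use \<tau> in \<open>auto simp: Z_def\<close>)
    ultimately have "Z \<subseteq> R" using components_maximal[OF R(1)] by blast
    then have "side r (\<beta> *\<^sub>R v) = R"
      by (intro side_eqI[OF R(1) \<tau>(1)]) (force simp: Z_def)
    then show "side r (\<beta> *\<^sub>R velocity t) = side s (\<sigma> *\<^sub>R velocity s + \<beta> *\<^sub>R velocity t)"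
      using side_s by (simp add: n0_def u_def v_def)
  qed
qed

text \<open>The directions on one side of the tangent form a convex half plane, on which
  \<open>side r\<close> is locally constant.\<close>

lemma side_eq_same_side:
  assumes "simple_point r" and pos: "(perp (velocity r) \<bullet> n) * (perp (velocity r) \<bullet> n') > 0"
  shows "side r n = side r n'"
proof -
  \<comment> \<open>The scalar factor adjusts the sign, so that the half plane contains
    \<open>n\<close> on whichever side it lies.\<close>
  define a where "a = (perp (velocity r) \<bullet> n) *\<^sub>R perp (velocity r)"
  have "side r constant_on {x. a \<bullet> x > 0}"
  proof (rule locally_constant_imp_constant)
    show "connected {x. a \<bullet> x > 0}" by (intro convex_connected convex_halfspace_gt)
    fix x assume x: "x \<in> {x. a \<bullet> x > 0}"
    then have "perp (velocity r) \<bullet> x \<noteq> 0" by (auto simp: a_def)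
    then obtain \<delta> R where \<delta>: "\<delta> > 0" "R \<in> components (- range c)" "\<And>r' n. dist r' r < \<delta> \<Longrightarrow> dist n x < \<delta> \<Longrightarrow> side r' n = R"
      using side_locally_constant[OF assms(1)] by blast
    show "\<exists>T. openin (top_of_set {x. a \<bullet> x > 0}) T \<and> x \<in> T \<and> (\<forall>y\<in>T. side r y = side r x)"
      by (rule exI[of _ "{x. a \<bullet> x > 0} \<inter> ball x \<delta>"])
        (use x \<delta> in \<open>auto simp: dist_commute openin_open_Int\<close>)
  qed
  moreover have "n \<in> {x. a \<bullet> x > 0}" "n' \<in> {x. a \<bullet> x > 0}"
    using pos by (auto simp: a_def zero_less_mult_iff)
  ultimately show ?thesis by (auto simp: constant_on_def)
qed

text \<open>The Fox color at a simple point \<open>r\<close>, indexed by the parameter instead of an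
  arc.\<close>

definition arc_sum :: "((real ^ 2) set \<Rightarrow> int) \<Rightarrow> real \<Rightarrow> int" where
  "arc_sum f r = f (side r (perp (velocity r))) + f (side r (- perp (velocity r)))"

text \<open>Lets the normal be replaced, near a crossing, by the velocity of the other strand, in
  terms of which the corners are defined. An opposite sign only swaps the summands.\<close>

lemma arc_sum_eq:
  assumes "simple_point r" "perp (velocity r) \<bullet> n \<noteq> 0"
  shows "arc_sum f r = f (side r n) + f (side r (- n))"
proof -
  define w where "w = velocity r"
  have w: "perp w \<bullet> perp w > 0" using velocity_nonzero by (simp add: perp_inner_perp w_def)
  note same = side_eq_same_side[OF assms(1), folded w_def]
  show ?thesis
  proof (cases "perp w \<bullet> n > 0")
    case True
    then have "side r (perp w) = side r n" "side r (- perp w) = side r (- n)"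
      using w by (auto intro!: same)
    then show ?thesis by (simp add: arc_sum_def w_def)
  next
    case False
    then have "perp w \<bullet> n < 0" using assms(2) by (simp add: w_def)
    then have "side r (perp w) = side r (- n)" "side r (- perp w) = side r n"
      using w by (auto intro!: same simp: mult_pos_neg)
    then show ?thesis by (simp add: arc_sum_def w_def)
  qed
qed

lemma arc_sum_near_simple_point:
  assumes "simple_point t"
  obtains \<delta> where "\<delta> > 0" "\<And>r. dist r t < \<delta> \<Longrightarrow> arc_sum f r = arc_sum f t"
proof -
  have "perp (velocity t) \<bullet> perp (velocity t) \<noteq> 0" "perp (velocity t) \<bullet> - perp (velocity t) \<noteq> 0"
    using velocity_nonzero by (simp_all add: perp_inner_perp)
  note transversal = this
  obtain \<delta>1 R1 where 1: "\<delta>1 > 0" "R1 \<in> components (- range c)"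
    "\<And>r n. dist r t < \<delta>1 \<Longrightarrow> dist n (perp (velocity t)) < \<delta>1 \<Longrightarrow> side r n = R1"
    using side_locally_constant[OF assms transversal(1)] by blast
  obtain \<delta>2 R2 where 2: "\<delta>2 > 0" "R2 \<in> components (- range c)"
    "\<And>r n. dist r t < \<delta>2 \<Longrightarrow> dist n (- perp (velocity t)) < \<delta>2 \<Longrightarrow> side r n = R2"
    using side_locally_constant[OF assms transversal(2)] by blast
  have "continuous_on UNIV (\<lambda>r. perp (velocity r))"
    by (intro continuous_intros continuous_velocity)
  moreover have "min \<delta>1 \<delta>2 > 0" using 1 2 by simp
  ultimately obtain \<delta>3 where 3: "\<delta>3 > 0"
    "\<And>r. dist r t < \<delta>3 \<Longrightarrow> dist (perp (velocity r)) (perp (velocity t)) < min \<delta>1 \<delta>2"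
    unfolding continuous_on_iff by blast
  have "arc_sum f r = f R1 + f R2" if "dist r t < min \<delta>3 (min \<delta>1 \<delta>2)" for r
    using that 1(3)[of r "perp (velocity r)"] 2(3)[of r "- perp (velocity r)"] 3(2)[of r]
    by (simp add: arc_sum_def dist_minus)
  moreover have "min \<delta>3 (min \<delta>1 \<delta>2) > 0" using 1 2 3 by simp
  ultimately show ?thesis using that by (metis dist_self)
qed

lemma double_point_not_simple:
  assumes "double_point s t"
  shows "\<not> simple_point s"
proof
  assume "simple_point s"
  then have "t - s \<in> \<int>" using assms by (simp add: simple_point_def double_point_def)
  then obtain k where "t = s + of_int k" by (metis Ints_cases add_diff_cancel_left' diff_add_cancel add.commute)
  then have "velocity t = velocity s" by (simp add: velocity_shift)
  then show False using assms by (simp add: double_point_def perp_inner_self)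
qed

definition corner :: "real \<Rightarrow> real \<Rightarrow> real \<Rightarrow> real \<Rightarrow> (real ^ 2) set" where
  "corner s t a b = side s (a *\<^sub>R velocity s + b *\<^sub>R velocity t)"

lemma corner_swap: "double_point s t \<Longrightarrow> corner t s a b = corner s t b a"
  unfolding corner_def by (subst add.commute, rule side_cong) (simp add: double_point_def)

lemma corner_shift: "corner (s + of_int k) t = corner s t"
  unfolding corner_def velocity_shift by (intro ext side_cong curve_shift)

lemma corner_in_components:
  assumes "double_point s t" "a \<noteq> 0" "b \<noteq> 0"
  shows "corner s t a b \<in> components (- range c)"
  unfolding corner_def
  by (rule side_at_double_point_in_components[OF assms(1)])
    (use assms perp_inner_skew[of "velocity t" "velocity s"] in
      \<open>auto simp: double_point_def inner_add_right perp_inner_self\<close>)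

lemma arc_sum_near_double_point:
  assumes dp: "double_point s t"
  obtains \<delta> where "\<delta> > 0"
    "\<And>r. dist r s < \<delta> \<Longrightarrow> simple_point r \<Longrightarrow> r < s \<Longrightarrow>
       arc_sum f r = f (corner s t (- 1) 1) + f (corner s t (- 1) (- 1))"
    "\<And>r. dist r s < \<delta> \<Longrightarrow> simple_point r \<Longrightarrow> s < r \<Longrightarrow>
       arc_sum f r = f (corner s t 1 1) + f (corner s t 1 (- 1))"
proof -
  have "\<exists>\<delta>>0. \<forall>r. dist r s < \<delta> \<longrightarrow> sgn (r - s) = \<sigma> \<longrightarrow> side r (\<beta> *\<^sub>R velocity t) = corner s t \<sigma> \<beta>"
    if "\<bar>\<sigma>\<bar> = 1" "\<bar>\<beta>\<bar> = 1" for \<sigma> \<beta> :: real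
    using side_near_double_point[OF dp that(2,1)] unfolding corner_def by metis
  then obtain d where d: "\<And>\<sigma> \<beta> :: real. \<bar>\<sigma>\<bar> = 1 \<Longrightarrow> \<bar>\<beta>\<bar> = 1 \<Longrightarrow> d \<sigma> \<beta> > 0"
    "\<And>\<sigma> \<beta> r. \<bar>\<sigma>\<bar> = 1 \<Longrightarrow> \<bar>\<beta>\<bar> = 1 \<Longrightarrow> dist r s < d \<sigma> \<beta> \<Longrightarrow> sgn (r - s) = \<sigma> \<Longrightarrow>
       side r (\<beta> *\<^sub>R velocity t) = corner s t \<sigma> \<beta>"
    by metis
  have "continuous_on UNIV (\<lambda>r. perp (velocity r) \<bullet> velocity t)"
    by (intro continuous_intros continuous_velocity)
  moreover have "\<bar>perp (velocity s) \<bullet> velocity t\<bar> > 0" using dp by (simp add: double_point_def)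
  \<comment> \<open>Within \<open>\<delta>1\<close> the determinant cannot vanish, so
    \<open>velocity t\<close> stays transverse to the curve at \<open>r\<close> and may be used to
    compute \<open>arc_sum\<close>.\<close>
  ultimately obtain \<delta>1 where \<delta>1: "\<delta>1 > 0" "\<And>r. dist r s < \<delta>1 \<Longrightarrow>
      dist (perp (velocity r) \<bullet> velocity t) (perp (velocity s) \<bullet> velocity t) < \<bar>perp (velocity s) \<bullet> velocity t\<bar>"
    unfolding continuous_on_iff by blast
  define \<delta> where "\<delta> = min \<delta>1 (min (min (d 1 1) (d 1 (- 1))) (min (d (- 1) 1) (d (- 1) (- 1))))"
  have sum: "arc_sum f r = f (corner s t \<sigma> 1) + f (corner s t \<sigma> (- 1))"
    if "dist r s < \<delta>" "simple_point r" "sgn (r - s) = \<sigma>" "\<sigma> = 1 \<or> \<sigma> = - 1" for r \<sigma>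
  proof -
    have "perp (velocity r) \<bullet> velocity t \<noteq> 0"
      using \<delta>1(2)[of r] that(1) by (auto simp: \<delta>_def dist_real_def)
    then have "arc_sum f r = f (side r (1 *\<^sub>R velocity t)) + f (side r ((- 1) *\<^sub>R velocity t))"
      using arc_sum_eq[OF that(2)] by simp
    then show ?thesis using that d(2)[of \<sigma> 1 r] d(2)[of \<sigma> "- 1" r] by (auto simp: \<delta>_def)
  qed
  have "\<delta> > 0" using \<delta>1(1) d(1) by (simp add: \<delta>_def)
  then show ?thesis using that sum[of _ "- 1"] sum[of _ 1] by simp
qed

end

section \<open>Integral colorings of knot diagrams\<close>

lemma eq_0_if_all_powers_of_2_dvd:
  fixes x :: int
  assumes "\<And>k. 2 ^ k dvd x"
  shows "x = 0"
proof (rule ccontr)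
  assume "x \<noteq> 0"
  then have "\<bar>2 ^ nat \<bar>x\<bar>\<bar> \<le> \<bar>x\<bar>" using dvd_imp_le_int assms by blast
  moreover have "nat \<bar>x\<bar> < 2 ^ nat \<bar>x\<bar>" by (rule less_exp)
  then have "int (nat \<bar>x\<bar>) < int (2 ^ nat \<bar>x\<bar>)" by (simp only: of_nat_less_iff)
  ultimately show False by simp
qed

context plane_loop
begin

text \<open>In this arrangement the Dehn condition says that the Fox color does not change along the
  strand at \<open>s\<close>, the upper one.\<close>

definition colored_crossing :: "((real ^ 2) set \<Rightarrow> int) \<Rightarrow> real \<Rightarrow> real \<Rightarrow> bool" where
  "colored_crossing f s t \<longleftrightarrow>
     f (corner s t 1 1) + f (corner s t 1 (- 1)) = f (corner s t (- 1) 1) + f (corner s t (- 1) (- 1))"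

lemma ex_simple_between:
  assumes "countable {r. \<not> simple_point r}" "a < b"
  obtains r where "simple_point r" "a < r" "r < b"
  using open_minus_countable[of "{r. \<not> simple_point r}" "{a<..<b}"] assms by auto

text \<open>Sums of adjacent corners are thus actual values of \<open>arc_sum\<close> at simple
  points, so congruences between such values apply to them.\<close>

lemma ex_arc_sum_at_double_point:
  assumes dense: "countable {r. \<not> simple_point r}" and dp: "double_point s t"
  shows "\<exists>r. simple_point r \<and> arc_sum f r = f (corner s t 1 1) + f (corner s t 1 (- 1))"
    and "\<exists>r. simple_point r \<and> arc_sum f r = f (corner s t (- 1) 1) + f (corner s t (- 1) (- 1))"
proof -
  obtain \<delta> where \<delta>: "\<delta> > 0"
    "\<And>r. dist r s < \<delta> \<Longrightarrow> simple_point r \<Longrightarrow> r < s \<Longrightarrow>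
       arc_sum f r = f (corner s t (- 1) 1) + f (corner s t (- 1) (- 1))"
    "\<And>r. dist r s < \<delta> \<Longrightarrow> simple_point r \<Longrightarrow> s < r \<Longrightarrow>
       arc_sum f r = f (corner s t 1 1) + f (corner s t 1 (- 1))"
    using arc_sum_near_double_point[OF dp, of f] by blast
  obtain r where r: "simple_point r" "s < r" "r < s + \<delta>"
    using ex_simple_between[OF dense, of s "s + \<delta>"] \<delta>(1) by auto
  show "\<exists>r. simple_point r \<and> arc_sum f r = f (corner s t 1 1) + f (corner s t 1 (- 1))"
    using r \<delta>(3)[of r] by (auto simp: dist_real_def)
  obtain r where r: "simple_point r" "s - \<delta> < r" "r < s"
    using ex_simple_between[OF dense, of "s - \<delta>" s] \<delta>(1) by auto
  show "\<exists>r. simple_point r \<and> arc_sum f r = f (corner s t (- 1) 1) + f (corner s t (- 1) (- 1))"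
    using r \<delta>(2)[of r] by (auto simp: dist_real_def)
qed

lemma arc_sum_over:
  assumes dp: "double_point s t" and col: "colored_crossing f s t"
  obtains \<delta> where "\<delta> > 0" "\<And>r r'. dist r s < \<delta> \<Longrightarrow> dist r' s < \<delta> \<Longrightarrow>
    simple_point r \<Longrightarrow> simple_point r' \<Longrightarrow> arc_sum f r = arc_sum f r'"
proof -
  obtain \<delta> where \<delta>: "\<delta> > 0"
    "\<And>r. dist r s < \<delta> \<Longrightarrow> simple_point r \<Longrightarrow> r < s \<Longrightarrow>
       arc_sum f r = f (corner s t (- 1) 1) + f (corner s t (- 1) (- 1))"
    "\<And>r. dist r s < \<delta> \<Longrightarrow> simple_point r \<Longrightarrow> s < r \<Longrightarrow>
       arc_sum f r = f (corner s t 1 1) + f (corner s t 1 (- 1))"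
    using arc_sum_near_double_point[OF dp, of f] by blast
  have "arc_sum f r = f (corner s t 1 1) + f (corner s t 1 (- 1))"
    if "dist r s < \<delta>" "simple_point r" for r
  proof -
    have "r \<noteq> s" using that double_point_not_simple[OF dp] by auto
    then show ?thesis using \<delta>(2,3)[OF that] col
      by (cases "r < s") (simp_all add: colored_crossing_def)
  qed
  then show ?thesis using that[OF \<delta>(1)] by simp
qed

lemma arc_sum_under:
  assumes dense: "countable {r. \<not> simple_point r}"
    and dp: "double_point s t" and col: "colored_crossing f s t"
    and mod: "\<And>r r'. simple_point r \<Longrightarrow> simple_point r' \<Longrightarrow> m dvd arc_sum f r - arc_sum f r'"
  obtains \<delta> where "\<delta> > 0" "\<And>r r'. dist r t < \<delta> \<Longrightarrow> dist r' t < \<delta> \<Longrightarrow>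
    simple_point r \<Longrightarrow> simple_point r' \<Longrightarrow> 2 * m dvd arc_sum f r - arc_sum f r'"
proof -
  have pd: "double_point t s" using dp by (rule double_point_swap)
  note swap = corner_swap[OF dp]
  obtain \<delta> where \<delta>: "\<delta> > 0"
    "\<And>r. dist r t < \<delta> \<Longrightarrow> simple_point r \<Longrightarrow> r < t \<Longrightarrow>
       arc_sum f r = f (corner t s (- 1) 1) + f (corner t s (- 1) (- 1))"
    "\<And>r. dist r t < \<delta> \<Longrightarrow> simple_point r \<Longrightarrow> t < r \<Longrightarrow>
       arc_sum f r = f (corner t s 1 1) + f (corner t s 1 (- 1))"
    using arc_sum_near_double_point[OF pd, of f] by blast
  define L R U where "L = f (corner s t 1 (- 1)) + f (corner s t (- 1) (- 1))"
    and "R = f (corner s t 1 1) + f (corner s t (- 1) 1)"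
    and "U = f (corner s t 1 1) + f (corner s t 1 (- 1))"
  obtain r where "simple_point r" "arc_sum f r = U"
    using ex_arc_sum_at_double_point(1)[OF dense dp] unfolding U_def by blast
  moreover obtain r where "simple_point r" "arc_sum f r = L"
    using ex_arc_sum_at_double_point(2)[OF dense pd] unfolding L_def swap by blast
  ultimately have "m dvd U - L" using mod by blast
  \<comment> \<open>The Fox relation: \<open>L\<close> and \<open>R\<close> belong to the under-arcs
    before and after the crossing, \<open>U\<close> to the over-arc. Since \<open>U - L\<close> is a
    multiple of \<open>m\<close>, the factor 2 is the gain.\<close>
  moreover have "R - L = 2 * (U - L)" using col by (simp add: colored_crossing_def L_def R_def U_def)
  ultimately have RL: "2 * m dvd R - L" by (metis dvd_refl mult_dvd_mono)
  then have LR: "2 * m dvd L - R" by (simp only: dvd_diff_commute)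
  have "arc_sum f r = L \<or> arc_sum f r = R" if "dist r t < \<delta>" "simple_point r" for r
  proof -
    have "r \<noteq> t" using that double_point_not_simple[OF pd] by auto
    then show ?thesis using \<delta>(2,3)[OF that]
      by (cases "r < t") (simp_all add: L_def R_def swap)
  qed
  then have "2 * m dvd arc_sum f r - arc_sum f r'"
    if "dist r t < \<delta>" "dist r' t < \<delta>" "simple_point r" "simple_point r'" for r r'
    using that RL LR by (metis diff_self dvd_0_right)
  then show ?thesis using that[OF \<delta>(1)] by blast
qed

text \<open>
  \<^term>\<open>arc_sum f\<close> is the Fox coloring associated with \<^term>\<open>f\<close>: at a crossing the two under-arcs
  average to the over-arc. If all values agree modulo \<open>2 ^ k\<close>, this forces the under-arcs to agree
  modulo \<open>2 ^ Suc k\<close>, and then so do all values because the curve is connected.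
\<close>

lemma arc_sum_cong_power_2:
  fixes X :: "(real \<times> real) set"
  assumes dense: "countable {r. \<not> simple_point r}"
    and dp: "\<And>s t. (s, t) \<in> X \<Longrightarrow> double_point s t"
    and cover: "\<And>a. \<not> simple_point a \<Longrightarrow> \<exists>(s, t)\<in>X. a - s \<in> \<int> \<or> a - t \<in> \<int>"
    and col: "\<And>s t. (s, t) \<in> X \<Longrightarrow> colored_crossing f s t"
    and "simple_point r" "simple_point r'"
  shows "2 ^ k dvd arc_sum f r - arc_sum f r'"
  using assms(5,6)
proof (induction k arbitrary: r r')
  case 0
  then show ?case by simp
next
  case (Suc k)
  show ?case
  \<comment> \<open>Local agreement near each parameter spreads along the connected line; only
    simple points are compared, and these are dense.\<close>
  proof (rule connected_equivalence_relation_gen[OF connected_UNIV UNIV_I UNIV_I Suc.prems])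
    show "2 ^ Suc k dvd arc_sum f x - arc_sum f z"
      if "2 ^ Suc k dvd arc_sum f x - arc_sum f y" "2 ^ Suc k dvd arc_sum f y - arc_sum f z" for x y z
      using dvd_add[OF that] by simp
    show "\<exists>z. z \<in> T \<and> simple_point z" if "openin (top_of_set UNIV) T" "a \<in> T" for T a
      using open_minus_countable[OF dense, of T] that by auto
    fix a :: real
    have "\<exists>\<delta>>0. \<forall>x y. dist x a < \<delta> \<longrightarrow> dist y a < \<delta> \<longrightarrow> simple_point x \<longrightarrow> simple_point y \<longrightarrow>
        2 ^ Suc k dvd arc_sum f x - arc_sum f y"
    proof (cases "simple_point a")
      case True
      then show ?thesis using arc_sum_near_simple_point[OF True, of f] by (metis diff_self dvd_0_right)
    next
      case False
      then obtain s t where st: "(s, t) \<in> X" "a - s \<in> \<int> \<or> a - t \<in> \<int>" using cover by blast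
      from st(2) show ?thesis
      proof
        assume "a - s \<in> \<int>"
        then obtain j where "a - s = of_int j" by (rule Ints_cases)
        then have a: "a = s + of_int j" by simp
        have "double_point a t" "colored_crossing f a t"
          using dp[OF st(1)] col[OF st(1)] by (simp_all add: a double_point_shift colored_crossing_def corner_shift)
        then show ?thesis using arc_sum_over[of a t f] by (metis diff_self dvd_0_right)
      next
        assume "a - t \<in> \<int>"
        then obtain j where "a - t = of_int j" by (rule Ints_cases)
        then have a: "a = t + of_int j" by simp
        have ta: "double_point t s" using dp[OF st(1)] by (rule double_point_swap)
        then have "double_point a s" unfolding a by (rule double_point_shift)
        then have sa: "double_point s a" by (rule double_point_swap)
        have "corner s a x y = corner s t x y" for x y
          using corner_swap[OF sa, of y x] corner_swap[OF ta, of x y] by (simp add: a corner_shift)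
        then have "colored_crossing f s a" using col[OF st(1)] by (simp add: colored_crossing_def)
        \<comment> \<open>The induction hypothesis is needed globally: the over-arc and the
          under-arc of a crossing may be far apart along the curve.\<close>
        from arc_sum_under[OF dense sa this, of "2 ^ k"] Suc.IH show ?thesis
          by (metis power_Suc)
      qed
    qed
    then obtain \<delta> where \<delta>: "\<delta> > 0" "\<And>x y. dist x a < \<delta> \<Longrightarrow> dist y a < \<delta> \<Longrightarrow>
        simple_point x \<Longrightarrow> simple_point y \<Longrightarrow> 2 ^ Suc k dvd arc_sum f x - arc_sum f y"
      by blast
    show "\<exists>T. openin (top_of_set UNIV) T \<and> a \<in> T \<and>
        (\<forall>x\<in>T. \<forall>y\<in>T. simple_point x \<and> simple_point y \<longrightarrow> 2 ^ Suc k dvd arc_sum f x - arc_sum f y)"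
    proof (intro exI conjI ballI impI)
      show "openin (top_of_set UNIV) (ball a \<delta>)" by simp
      show "a \<in> ball a \<delta>" using \<delta>(1) by simp
      fix x y assume "x \<in> ball a \<delta>" "y \<in> ball a \<delta>" "simple_point x \<and> simple_point y"
      then show "2 ^ Suc k dvd arc_sum f x - arc_sum f y"
        by (intro \<delta>(2)) (simp_all add: dist_commute)
    qed
  qed
qed

text \<open>A constant Fox coloring makes the sums of two adjacent corners equal; comparing two such
  sums that share a corner shows opposite corners to be equal.\<close>

lemma integral_coloring_trivial:
  fixes X :: "(real \<times> real) set"
  assumes dense: "countable {r. \<not> simple_point r}"
    and dp: "\<And>s t. (s, t) \<in> X \<Longrightarrow> double_point s t"
    and cover: "\<And>a. \<not> simple_point a \<Longrightarrow> \<exists>(s, t)\<in>X. a - s \<in> \<int> \<or> a - t \<in> \<int>"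
    and col: "\<And>s t. (s, t) \<in> X \<Longrightarrow> colored_crossing f s t"
    and st: "(s, t) \<in> X"
  shows "f (corner s t 1 1) = f (corner s t (- 1) (- 1))"
    and "f (corner s t 1 (- 1)) = f (corner s t (- 1) 1)"
proof -
  have eq: "arc_sum f r = arc_sum f r'" if "simple_point r" "simple_point r'" for r r'
    using eq_0_if_all_powers_of_2_dvd[OF arc_sum_cong_power_2[OF dense dp cover col that]] by simp
  have pd: "double_point t s" using dp[OF st] by (rule double_point_swap)
  note swap = corner_swap[OF dp[OF st]]
  obtain r1 where "simple_point r1" "arc_sum f r1 = f (corner s t 1 1) + f (corner s t 1 (- 1))"
    using ex_arc_sum_at_double_point(1)[OF dense dp[OF st]] by blast
  moreover obtain r2 where "simple_point r2" "arc_sum f r2 = f (corner s t 1 1) + f (corner s t (- 1) 1)"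
    using ex_arc_sum_at_double_point(1)[OF dense pd, of f] unfolding swap by blast
  moreover obtain r3 where "simple_point r3" "arc_sum f r3 = f (corner s t 1 (- 1)) + f (corner s t (- 1) (- 1))"
    using ex_arc_sum_at_double_point(2)[OF dense pd, of f] unfolding swap by blast
  ultimately show "f (corner s t 1 1) = f (corner s t (- 1) (- 1))"
    and "f (corner s t 1 (- 1)) = f (corner s t (- 1) 1)"
    using eq[of r1 r2] eq[of r1 r3] by simp_all
qed

end

text \<open>
  \<^term>\<open>N\<close> is the set of colors and \<^term>\<open>Q\<close> lists the colors of the four corners of each crossing. Subtracting
  \<^term>\<open>c0\<close> normalizes one color to 0, so that only the remaining \<open>card N - 1\<close> columns are left.
\<close>

lemma integral_lift_of_coloring:
  fixes N :: "int set" and Q :: "(int \<times> int \<times> int \<times> int) set" and p :: int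
  assumes N: "finite N" "c0 \<in> N" and p: "2 ^ (card N - 1) < p"
    and Q: "\<And>a b c d. (a, b, c, d) \<in> Q \<Longrightarrow> a \<in> N \<and> b \<in> N \<and> c \<in> N \<and> d \<in> N \<and> p dvd a - b + c - d"
  obtains h m where "\<not> p dvd m" "\<And>j. j \<in> N \<Longrightarrow> p dvd h j - m * (j - c0)"
    "\<And>a b c d. (a, b, c, d) \<in> Q \<Longrightarrow> h a - h b + h c - h d = 0"
proof -
  define row :: "int \<times> int \<times> int \<times> int \<Rightarrow> int \<Rightarrow> int" where
    "row = (\<lambda>(a, b, c, d) j. of_bool (j = a) - of_bool (j = b) + (of_bool (j = c) - of_bool (j = d)))"
  have eval: "(\<Sum>j\<in>N - {c0}. row (a, b, c, d) j * g j) = g a - g b + g c - g d"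
    if "(a, b, c, d) \<in> Q" "g c0 = 0" for a b c d g
  proof -
    have pick: "(\<Sum>j\<in>N - {c0}. of_bool (j = z) * g j) = g z" if "z \<in> N" for z
    proof -
      have "(\<Sum>j\<in>N - {c0}. of_bool (j = z) * g j) = (\<Sum>j\<in>N. of_bool (j = z) * g j)"
        by (rule sum.mono_neutral_left) (use N \<open>g c0 = 0\<close> in auto)
      also have "\<dots> = (\<Sum>j\<in>{z}. of_bool (j = z) * g j)"
        by (rule sum.mono_neutral_right) (use N that in auto)
      finally show ?thesis by simp
    qed
    have "(\<Sum>j\<in>N - {c0}. row (a, b, c, d) j * g j) =
        (\<Sum>j\<in>N - {c0}. of_bool (j = a) * g j) - (\<Sum>j\<in>N - {c0}. of_bool (j = b) * g j)
      + ((\<Sum>j\<in>N - {c0}. of_bool (j = c) * g j) - (\<Sum>j\<in>N - {c0}. of_bool (j = d) * g j))"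
      unfolding sum_subtractf[symmetric] sum.distrib[symmetric]
      by (rule sum.cong) (simp_all add: row_def algebra_simps)
    also have "\<dots> = g a - g b + g c - g d" using Q[OF that(1)] by (simp only: pick)
    finally show ?thesis .
  qed
  obtain y m where y: "\<not> p dvd m" "\<And>j. p dvd y j - m * (j - c0)"
    "\<And>e. e \<in> row ` Q \<Longrightarrow> (\<Sum>j\<in>N - {c0}. e j * y j) = 0"
  proof (rule lift_solution_mod_prime[of "N - {c0}" "row ` Q" p "\<lambda>j. j - c0"])
    show "finite (N - {c0})" using N by simp
    show "p dvd (\<Sum>j\<in>N - {c0}. e j * (j - c0))" if e: "e \<in> row ` Q" for e
    proof -
      obtain a b c d where e: "e = row (a, b, c, d)" "(a, b, c, d) \<in> Q" using e by auto
      have "(\<Sum>j\<in>N - {c0}. e j * (j - c0)) = (a - c0) - (b - c0) + (c - c0) - (d - c0)"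
        unfolding e(1) by (rule eval[OF e(2)]) simp
      also have "\<dots> = a - b + c - d" by simp
      finally show ?thesis using Q[OF e(2)] by simp
    qed
    fix r :: nat and \<rho> g
    assume \<rho>: "\<rho> ` {..<r} \<subseteq> row ` Q" and g: "inj_on g {..<r}" "g ` {..<r} \<subseteq> N - {c0}"
    have "\<exists>q. \<rho> i = row q" if "i < r" for i using \<rho> that by blast
    then obtain q where q: "\<And>i. i < r \<Longrightarrow> \<rho> i = row (q i)" by metis
    define a b c d where "a i = fst (q i)" and "b i = fst (snd (q i))"
      and "c i = fst (snd (snd (q i)))" and "d i = snd (snd (snd (q i)))" for i
    note abcd = a_def b_def c_def d_def
    \<comment> \<open>Every row carries the second summand, so each of the at most
      \<open>card N - 1\<close> rows contributes a factor 2.\<close>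
    have "mat r r (\<lambda>(i, j). \<rho> i (g j)) = mat r r (\<lambda>(i, j). of_bool (g j = a i) - of_bool (g j = b i)
        + of_bool (i \<in> {..<r}) * (of_bool (g j = c i) - of_bool (g j = d i)))"
      by (rule eq_matI) (auto simp: q abcd row_def case_prod_beta)
    then have "\<bar>det (mat r r (\<lambda>(i, j). \<rho> i (g j)))\<bar> \<le> 2 ^ card {..<r}"
      using abs_det_double_incidence_le[OF finite_lessThan subset_refl g(1)] by simp
    also have "r \<le> card (N - {c0})"
      using card_image[OF g(1)] card_mono[OF _ g(2)] N by simp
    then have "(2 :: int) ^ card {..<r} \<le> 2 ^ (card N - 1)" using N by simp
    also note p
    finally show "\<bar>det (mat r r (\<lambda>(i, j). \<rho> i (g j)))\<bar> < p" .
  qed blast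
  \<comment> \<open>The equations do not constrain \<open>y c0\<close>, as \<open>c0\<close> is no
    column; the value 0 is the one under which omitting that column is correct.\<close>
  define h where "h j = (if j = c0 then 0 else y j)" for j
  show ?thesis
  proof (rule that[OF y(1)])
    show "p dvd h j - m * (j - c0)" for j using y(2)[of j] by (simp add: h_def)
    fix a b c d assume q: "(a, b, c, d) \<in> Q"
    have "h a - h b + h c - h d = (\<Sum>j\<in>N - {c0}. row (a, b, c, d) j * h j)"
      by (rule eval[OF q, symmetric]) (simp add: h_def)
    also have "\<dots> = (\<Sum>j\<in>N - {c0}. row (a, b, c, d) j * y j)"
      by (rule sum.cong) (auto simp: h_def)
    also have "\<dots> = 0" using y(3) q by blast
    finally show "h a - h b + h c - h d = 0" .
  qed
qed

section \<open>Application to knot diagrams\<close>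

locale knot_diagram_loop =
  fixes D :: diagram
  assumes diagram: "knot_diagram D"

sublocale knot_diagram_loop \<subseteq> plane_loop "curve D"
  using diagram by unfold_locales (simp add: knot_diagram_def)

context knot_diagram_loop
begin

lemma curve_frac: "curve D (frac r) = curve D r"
  using curve_shift[of "frac r" "\<lfloor>r\<rfloor>"] by (simp add: frac_def)

lemma frac_unit_interval: "frac r \<in> {0..<1}"
  by (simp add: frac_lt_1)

lemma diff_frac_Ints: "r - frac r \<in> \<int>"
  by (simp add: frac_def)

lemma crossing_iff:
  "s \<in> {0..<1} \<Longrightarrow> t \<in> {0..<1} \<Longrightarrow>
    s \<noteq> t \<and> curve D s = curve D t \<longleftrightarrow> (s, t) \<in> crossings D \<or> (t, s) \<in> crossings D"
  using diagram unfolding knot_diagram_def by blast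

lemma crossing_is_double_point:
  assumes "(s, t) \<in> crossings D"
  shows "double_point s t"
proof -
  have st: "s \<in> {0..<1}" "t \<in> {0..<1}" using diagram assms by (auto simp: knot_diagram_def)
  have eq: "s \<noteq> t" "curve D s = curve D t" using crossing_iff[OF st] assms by auto
  have "\<not> collinear {0, velocity s, velocity t}"
    using diagram assms unfolding knot_diagram_def by blast
  moreover have "r - s \<in> \<int> \<or> r - t \<in> \<int>" if "curve D r = curve D s" for r
  proof -
    have "\<And>r s t. r \<in> {0..<1} \<Longrightarrow> s \<in> {0..<1} \<Longrightarrow> t \<in> {0..<1} \<Longrightarrow>
        curve D r = curve D s \<and> curve D s = curve D t \<Longrightarrow> r = s \<or> s = t \<or> r = t"
      using diagram unfolding knot_diagram_def by blast
    from this[OF frac_unit_interval st] have "frac r = s \<or> frac r = t"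
      using that eq by (simp add: curve_frac)
    then show ?thesis using diff_frac_Ints[of r] by auto
  qed
  ultimately show ?thesis using eq by (simp add: double_point_def perp_inner_nonzero)
qed

lemma not_simple_point_crossing:
  assumes "\<not> simple_point a"
  shows "\<exists>(s, t)\<in>crossings D. a - s \<in> \<int> \<or> a - t \<in> \<int>"
proof -
  obtain r where r: "curve D r = curve D a" "r - a \<notin> \<int>" using assms by (auto simp: simple_point_def)
  have "frac r \<noteq> frac a"
  proof
    assume "frac r = frac a"
    then have "r - a = of_int (\<lfloor>r\<rfloor> - \<lfloor>a\<rfloor>)" by (simp add: frac_def algebra_simps)
    then show False using r(2) by (metis Ints_of_int)
  qed
  then have "(frac r, frac a) \<in> crossings D \<or> (frac a, frac r) \<in> crossings D"
    using crossing_iff[OF frac_unit_interval frac_unit_interval, of r a] r(1) by (simp add: curve_frac)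
  then show ?thesis using diff_frac_Ints[of a] by blast
qed

lemma countable_not_simple_point: "countable {a. \<not> simple_point a}"
proof -
  have each: "countable (\<Union>k::int. {s + of_int k, t + of_int k})" for s t :: real
    by (intro countable_UN) auto
  have "{a. \<not> simple_point a} \<subseteq> (\<Union>(s, t)\<in>crossings D. \<Union>k::int. {s + of_int k, t + of_int k})"
  proof
    fix a assume "a \<in> {a. \<not> simple_point a}"
    then obtain s t where st: "(s, t) \<in> crossings D" "a - s \<in> \<int> \<or> a - t \<in> \<int>"
      using not_simple_point_crossing by blast
    then obtain k where "a - s = of_int k \<or> a - t = of_int k" by (metis Ints_cases)
    then have "a \<in> {s + of_int k, t + of_int k}" by auto
    then show "a \<in> (\<Union>(s, t)\<in>crossings D. \<Union>k::int. {s + of_int k, t + of_int k})" using st(1) by blast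
  qed
  moreover have "finite (crossings D)" using diagram by (simp add: knot_diagram_def)
  then have "countable (\<Union>(s, t)\<in>crossings D. \<Union>k::int. {s + of_int k, t + of_int k})"
    by (intro countable_UN[OF countable_finite]) (auto simp only: prod.case each)
  ultimately show ?thesis by (rule countable_subset)
qed

lemma corner_region_eq: "corner_region D x a b = corner (fst x) (snd x) a b"
  by (simp add: corner_region_def corner_def side_def regions_def Let_def)

lemmas region_eqs = region_x1_def region_x2_def region_x3_def region_x4_def corner_region_eq fst_conv snd_conv

lemma card_colors_used_ge:
  assumes p: "prime p" and C: "dehn_coloring p D C" and nontriv: "\<not> trivial_coloring D C"
  shows "p \<le> 2 ^ (card (colors_used D C) - 1)" and "colors_used D C \<noteq> {}"
proof -
  obtain s0 t0 where X0: "(s0, t0) \<in> crossings D" "\<not> trivially_colored_at D C (s0, t0)"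
    using nontriv by (auto simp: trivial_coloring_def)
  define N where "N = colors_used D C"
  have N: "C (corner s t a b) \<in> N" if "(s, t) \<in> crossings D" "a \<noteq> 0" "b \<noteq> 0" for s t a b
    using corner_in_components[OF crossing_is_double_point[OF that(1)] that(2,3)]
    by (auto simp: N_def colors_used_def regions_def)
  have range: "N \<subseteq> {0..int p - 1}"
    using C by (auto simp: dehn_coloring_def N_def colors_used_def residue_ring_def)
  then have fin: "finite N" by (rule finite_subset) simp
  define c0 where "c0 = C (corner s0 t0 1 1)"
  have c0: "c0 \<in> N" using N X0(1) by (simp add: c0_def)
  then show "colors_used D C \<noteq> {}" by (auto simp: N_def)
  show "p \<le> 2 ^ (card (colors_used D C) - 1)"
  proof (rule ccontr)
    assume "\<not> ?thesis"
    then have "2 ^ (card N - 1) < p" by (simp add: N_def)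
    then have less: "2 ^ (card N - 1) < int p" by (metis of_nat_less_iff of_nat_numeral of_nat_power)
    define Q where "Q = (\<lambda>(s, t). (C (corner s t 1 1), C (corner s t (- 1) 1),
        C (corner s t 1 (- 1)), C (corner s t (- 1) (- 1)))) ` crossings D"
    have Q: "a \<in> N \<and> b \<in> N \<and> c \<in> N \<and> d \<in> N \<and> int p dvd a - b + c - d" if q: "(a, b, c, d) \<in> Q" for a b c d
    proof -
      obtain s t where st: "(s, t) \<in> crossings D"
        and abcd: "a = C (corner s t 1 1)" "b = C (corner s t (- 1) 1)"
          "c = C (corner s t 1 (- 1))" "d = C (corner s t (- 1) (- 1))"
        using q by (auto simp: Q_def)
      have "(a + c) mod int p = (b + d) mod int p"
        using C st unfolding dehn_coloring_def residue_ring_def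
        by (fastforce simp: abcd region_eqs)
      then have "int p dvd (a + c) - (b + d)" by (simp add: mod_eq_dvd_iff)
      then show ?thesis using N[OF st] by (simp add: abcd algebra_simps)
    qed
    obtain h m where h: "\<not> int p dvd m" "\<And>j. j \<in> N \<Longrightarrow> int p dvd h j - m * (j - c0)"
      "\<And>a b c d. (a, b, c, d) \<in> Q \<Longrightarrow> h a - h b + h c - h d = 0"
    proof (rule integral_lift_of_coloring[OF fin c0 less Q])
      fix h m
      assume "\<not> int p dvd m" "\<And>j. j \<in> N \<Longrightarrow> int p dvd h j - m * (j - c0)"
        "\<And>a b c d. (a, b, c, d) \<in> Q \<Longrightarrow> h a - h b + h c - h d = 0"
      then show thesis by (rule that)
    qed
    have col: "colored_crossing (\<lambda>R. h (C R)) s t" if "(s, t) \<in> crossings D" for s t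
      using h(3)[of "C (corner s t 1 1)" "C (corner s t (- 1) 1)" "C (corner s t 1 (- 1))" "C (corner s t (- 1) (- 1))"] that
      by (force simp: colored_crossing_def Q_def)
    \<comment> \<open>\<open>m\<close> is invertible modulo \<open>p\<close> and colors are least
      residues, so \<open>h\<close> separates them.\<close>
    have inj: "x = y" if "x \<in> N" "y \<in> N" "h x = h y" for x y
    proof -
      have "int p dvd (h y - m * (y - c0)) - (h x - m * (x - c0))" by (rule dvd_diff[OF h(2)[OF that(2)] h(2)[OF that(1)]])
      then have "int p dvd m * (x - y)" using that(3) by (simp add: algebra_simps)
      then have "int p dvd x - y" using h(1) p by (simp add: prime_dvd_mult_iff)
      moreover have "x \<in> {0..int p - 1}" "y \<in> {0..int p - 1}" using range that by auto
      ultimately show ?thesis by (simp add: mod_eq_dvd_iff[symmetric])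
    qed
    note triv = integral_coloring_trivial[OF countable_not_simple_point crossing_is_double_point
        not_simple_point_crossing col X0(1)]
    have "trivially_colored_at D C (s0, t0)"
      unfolding trivially_colored_at_def region_eqs
    proof
      show "C (corner s0 t0 1 1) = C (corner s0 t0 (- 1) (- 1))"
        by (rule inj[OF _ _ triv(1)]) (simp_all add: N[OF X0(1)])
      show "C (corner s0 t0 1 (- 1)) = C (corner s0 t0 (- 1) 1)"
        by (rule inj[OF _ _ triv(2)]) (simp_all add: N[OF X0(1)])
    qed
    then show False using X0(2) by simp
  qed
qed

end

theorem theorem1p5:
  fixes p :: nat and K :: "(real ^ 3) set"
  assumes "prime p" and "odd p"
    and "knot K" and "dehn_colorable p K"
  shows "real (mincol_dehn p K) \<ge> log 2 (real p) + 1 \<and>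
         int (mincol_dehn p K) \<ge> \<lfloor>log 2 (real p)\<rfloor> + 2"
proof -
  define n where "n = mincol_dehn p K"
  have "\<exists>D C. nontrivially_colored_diagram_of p K D C \<and> n = card (colors_used D C)"
    unfolding n_def mincol_dehn_def
    by (rule LeastI_ex) (use assms(4) in \<open>auto simp: dehn_colorable_def\<close>)
  then obtain D C where DC: "nontrivially_colored_diagram_of p K D C" and n: "n = card (colors_used D C)"
    by blast
  have D: "knot_diagram D" "dehn_coloring p D C" "\<not> trivial_coloring D C"
    using DC by (auto simp: nontrivially_colored_diagram_of_def diagram_of_def)
  interpret knot_diagram_loop D by unfold_locales (rule D(1))
  note bound = card_colors_used_ge[OF assms(1) D(2,3), folded n]
  have "finite (colors_used D C)"
    by (rule finite_subset[of _ "{0..int p - 1}"])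
      (use D(2) in \<open>auto simp: dehn_coloring_def colors_used_def residue_ring_def\<close>)
  then have n1: "n \<ge> 1" using bound(2) by (simp add: n Suc_le_eq card_gt_0_iff)
  have p1: "p > 1" using assms(1) by (rule prime_gt_1_nat)
  \<comment> \<open>An odd number above 1 is no power of 2, so the bound becomes strict; strictness
    yields the summand 2 next to the floor.\<close>
  have "p \<noteq> 2 ^ (n - 1)" using assms(2) p1 by (cases "n - 1") auto
  then have "p < 2 ^ (n - 1)" using bound(1) by simp
  then have "real p < 2 powr real (n - 1)" by (simp add: powr_realpow)
  then have "log 2 (real p) < real (n - 1)" using p1 by (simp add: log_less_iff)
  then have lt: "log 2 (real p) < real n - 1" using n1 by (simp add: of_nat_diff)
  then have "\<lfloor>log 2 (real p)\<rfloor> < int n - 1" by (simp add: floor_less_iff)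
  with lt show ?thesis by (simp add: n_def)
qed

end
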